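(* Let $G$ be a connected threshold graph with vertex set $[n]$ split into intervals $I_0,\dots,I_k$ by vertex type, with $k>2$, and let $1\le t\le k-2$. Then the eigenpolytope $P_t$ is a simplex, but there are faces of $P_t$ of dimension at least $1$ that have points of the eigenconfiguration $\mathcal{B}_t=\{b_1,\dots,b_n\}$ in their relative interior. For every such face $F$ and every uniformly weighted design $W\subset[n]$ of $G$ of strength $t$, the set $W$ contains all or none of the indices $i\in[n]$ with $b_i\in F$. In particular, some facet of $P_t$ has a normal vector that is not a $2$-witness direction of $\mathcal{B}_t$, and thus there is a minimal positively weighted design of $G$ of strength $t$ that is not uniformly weighted.
   Context: A threshold graph is a graph with vertices $1,\dots,n$ such that each vertex $i$ is either connected to all vertices before it (a dominating vertex) or to none of the vertices before it (an isolated vertex). The set $[n]=\{1,\dots,n\}$ is split into intervals of consecutive integers $I_0,\dots,I_k$ (in increasing order) by vertex type: $I_0=\{1\}$, and $I_1,\dots,I_k$ are the maximal runs of consecutive vertices of the same type (all dominating or all isolated) among $2,\dots,n$, so consecutive intervals among $I_1,\dots,I_k$ have different types. It is a known fact that the Laplacian of a connected threshold graph has exactly $k+1$ distinct eigenvalues. The Laplacian $L$ is the $n\times n$ matrix with $L_{ii}=\deg(i)$, $L_{ij}=-1$ if $\{i,j\}$ is an edge, and $L_{ij}=0$ otherwise. Let $0=\lambda_0<\lambda_1<\cdots<\lambda_k$ be its distinct eigenvalues, with eigenspaces $E_0,\dots,E_k\subset\mathbb{R}^n$ (vectors are viewed as functions $[n]\to\mathbb{R}$). A subset $W\subset[n]$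 with weights $a_w\in\mathbb{R}$ ($w\in W$) averages $f:[n]\to\mathbb{R}$ if $\frac1n\sum_{v\in[n]}f(v)=\sum_{w\in W}a_wf(w)$. It is a graphical design of strength $t$ if it averages every $f\in E_0\oplus\cdots\oplus E_t$. It is positively weighted if $a_w>0$ for all $w\in W$, and uniformly weighted if there is $a>0$ with $a_w=a$ for all $w\in W$; a set $W$ is called a positively (uniformly) weighted design if it is one for some such weights. A positively weighted design $W$ of strength $t$ is minimal if no proper subset of $W$ is a positively weighted design of strength $t$. Let $\beta=\sum_{i=t+1}^k\dim E_i$ and let $B\in\mathbb{R}^{\beta\times n}$ be a matrix whose rows are the union of chosen bases of $E_{t+1},\dots,E_k$ (the choice is arbitrary). The $t$-th eigenconfiguration $\mathcal{B}_t=\{b_1,\dots,b_n\}\subset\mathbb{R}^\beta$ is the multiset of columns of $B$, and the $t$-th eigenpolytope is $P_t=\operatorname{conv}(\mathcal{B}_t)$, which is $\beta$-dimensional. A vector $a\in\mathbb{R}^\beta$ is a $2$-witness direction of $\mathcal{B}_t$ if $a^\top x$ takes exactly two values on the points of $\mathcal{B}_t$. *)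

theory Defs
  imports "HOL-Analysis.Analysis"
begin

text \<open>
  The ordered vertex set 1, ..., n is rendered by a finite linearly ordered type 'n with
  CARD('n) = n, so that vectors indexed by the vertices are elements of real ^ 'n. A graph is
  given by its adjacency relation.
\<close>

section \<open>Threshold graphs\<close>

definition first_vertex :: "'n::{finite,linorder}" where
  "first_vertex = Min UNIV"

definition dominating :: "('n::{finite,linorder} \<Rightarrow> 'n \<Rightarrow> bool) \<Rightarrow> 'n \<Rightarrow> bool" where
  "dominating adj i \<longleftrightarrow> (\<forall>j<i. adj i j)"

definition isolated :: "('n::{finite,linorder} \<Rightarrow> 'n \<Rightarrow> bool) \<Rightarrow> 'n \<Rightarrow> bool" where
  "isolated adj i \<longleftrightarrow> (\<forall>j<i. \<not> adj i j)"

definition threshold_graph :: "('n::{finite,linorder} \<Rightarrow> 'n \<Rightarrow> bool) \<Rightarrow> bool" where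
  "threshold_graph adj \<longleftrightarrow>
     symp adj \<and> irreflp adj \<and> (\<forall>i. dominating adj i \<or> isolated adj i)"

definition connected_graph :: "('n \<Rightarrow> 'n \<Rightarrow> bool) \<Rightarrow> bool" where
  "connected_graph adj \<longleftrightarrow> (\<forall>u v. adj\<^sup>*\<^sup>* u v)"

text \<open>The first vertex is vacuously of both types; it is kept out of all runs.\<close>

definition type_run :: "('n::{finite,linorder} \<Rightarrow> 'n \<Rightarrow> bool) \<Rightarrow> 'n set \<Rightarrow> bool" where
  "type_run adj R \<longleftrightarrow>
     R \<noteq> {} \<and> first_vertex \<notin> R \<and> (\<forall>u\<in>R. \<forall>w\<in>R. {u..w} \<subseteq> R) \<and>
     ((\<forall>v\<in>R. dominating adj v) \<or> (\<forall>v\<in>R. isolated adj v))"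

definition maximal_type_run :: "('n::{finite,linorder} \<Rightarrow> 'n \<Rightarrow> bool) \<Rightarrow> 'n set \<Rightarrow> bool" where
  "maximal_type_run adj R \<longleftrightarrow>
     type_run adj R \<and> (\<forall>R'. type_run adj R' \<and> R \<subseteq> R' \<longrightarrow> R' = R)"

definition type_intervals ::
  "('n::{finite,linorder} \<Rightarrow> 'n \<Rightarrow> bool) \<Rightarrow> nat \<Rightarrow> (nat \<Rightarrow> 'n set) \<Rightarrow> bool" where
  "type_intervals adj k I \<longleftrightarrow>
     I 0 = {first_vertex} \<and>
     bij_betw I {1..k} {R. maximal_type_run adj R} \<and>
     (\<forall>i j. i < j \<and> j \<le> k \<longrightarrow> (\<forall>u\<in>I i. \<forall>v\<in>I j. u < v))"

section \<open>Laplacian and its eigenspaces\<close>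

definition degree :: "('n::finite \<Rightarrow> 'n \<Rightarrow> bool) \<Rightarrow> 'n \<Rightarrow> nat" where
  "degree adj i = card {j. adj i j}"

definition laplacian :: "('n::finite \<Rightarrow> 'n \<Rightarrow> bool) \<Rightarrow> real ^ 'n ^ 'n" where
  "laplacian adj =
     (\<chi> i j. if i = j then real (degree adj i) else if adj i j then - 1 else 0)"

definition eigenvalues :: "real ^ 'n ^ 'n \<Rightarrow> real set" where
  "eigenvalues A = {l. \<exists>x. x \<noteq> 0 \<and> A *v x = l *\<^sub>R x}"

text \<open>The \<open>i\<close>-th smallest (from \<open>i = 0\<close>) of the distinct Laplacian eigenvalues; meaningful for
  \<open>i < card (eigenvalues (laplacian adj))\<close>.\<close>

definition lap_eigenvalue :: "('n::finite \<Rightarrow> 'n \<Rightarrow> bool) \<Rightarrow> nat \<Rightarrow> real" where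
  "lap_eigenvalue adj i = sorted_list_of_set (eigenvalues (laplacian adj)) ! i"

definition lap_eigenspace :: "('n::finite \<Rightarrow> 'n \<Rightarrow> bool) \<Rightarrow> nat \<Rightarrow> (real ^ 'n) set" where
  "lap_eigenspace adj i = {x. laplacian adj *v x = lap_eigenvalue adj i *\<^sub>R x}"

section \<open>Graphical designs\<close>

definition averages :: "'n set \<Rightarrow> ('n \<Rightarrow> real) \<Rightarrow> real ^ 'n \<Rightarrow> bool" where
  "averages W a f \<longleftrightarrow>
     (1 / real CARD('n)) * (\<Sum>v\<in>UNIV. f $ v) = (\<Sum>w\<in>W. a w * f $ w)"

definition graphical_design ::
  "('n::finite \<Rightarrow> 'n \<Rightarrow> bool) \<Rightarrow> nat \<Rightarrow> 'n set \<Rightarrow> ('n \<Rightarrow> real) \<Rightarrow> bool" where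
  "graphical_design adj t W a \<longleftrightarrow>
     (\<forall>f \<in> span (\<Union>i\<in>{0..t}. lap_eigenspace adj i). averages W a f)"

definition positively_weighted_design ::
  "('n::finite \<Rightarrow> 'n \<Rightarrow> bool) \<Rightarrow> nat \<Rightarrow> 'n set \<Rightarrow> bool" where
  "positively_weighted_design adj t W \<longleftrightarrow>
     (\<exists>a. (\<forall>w\<in>W. a w > 0) \<and> graphical_design adj t W a)"

definition uniformly_weighted_design ::
  "('n::finite \<Rightarrow> 'n \<Rightarrow> bool) \<Rightarrow> nat \<Rightarrow> 'n set \<Rightarrow> bool" where
  "uniformly_weighted_design adj t W \<longleftrightarrow>
     (\<exists>a. (\<exists>c>0. \<forall>w\<in>W. a w = c) \<and> graphical_design adj t W a)"

definition minimal_positively_weighted_design ::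
  "('n::finite \<Rightarrow> 'n \<Rightarrow> bool) \<Rightarrow> nat \<Rightarrow> 'n set \<Rightarrow> bool" where
  "minimal_positively_weighted_design adj t W \<longleftrightarrow>
     positively_weighted_design adj t W \<and>
     (\<forall>W'. W' \<subset> W \<longrightarrow> \<not> positively_weighted_design adj t W')"

section \<open>Eigenpolytopes\<close>

definition eigen_dim :: "('n::finite \<Rightarrow> 'n \<Rightarrow> bool) \<Rightarrow> nat \<Rightarrow> nat \<Rightarrow> nat" where
  "eigen_dim adj t k = (\<Sum>i=t+1..k. dim (lap_eigenspace adj i))"

text \<open>
  The row index type 'b has exactly as many elements as there are basis vectors in total, so
  each basis vector occurs as a row exactly once.
\<close>

definition eigen_matrix ::
  "('n::finite \<Rightarrow> 'n \<Rightarrow> bool) \<Rightarrow> nat \<Rightarrow> nat \<Rightarrow> real ^ 'n ^ 'b::finite \<Rightarrow> bool" where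
  "eigen_matrix adj t k B \<longleftrightarrow>
     CARD('b) = eigen_dim adj t k \<and>
     (\<exists>C. (\<forall>i\<in>{t+1..k}. independent (C i) \<and> span (C i) = lap_eigenspace adj i) \<and>
          rows B = (\<Union>i\<in>{t+1..k}. C i))"

text \<open>The points of the eigenconfiguration are the vectors \<open>column i B\<close>, with multiplicity
  recorded by the index \<open>i\<close>.\<close>

definition eigenpolytope :: "real ^ 'n ^ 'b \<Rightarrow> (real ^ 'b) set" where
  "eigenpolytope B = convex hull (range (\<lambda>i. column i B))"

definition two_witness_direction :: "real ^ 'n ^ 'b \<Rightarrow> real ^ 'b::finite \<Rightarrow> bool" where
  "two_witness_direction B a \<longleftrightarrow> card (range (\<lambda>i. a \<bullet> column i B)) = 2"

definition facet_normal :: "('a::euclidean_space) set \<Rightarrow> 'a set \<Rightarrow> 'a \<Rightarrow> bool" where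
  "facet_normal P F a \<longleftrightarrow>
     F facet_of P \<and> a \<noteq> 0 \<and>
     (\<exists>c. P \<subseteq> {x. a \<bullet> x \<le> c} \<and> F = P \<inter> {x. a \<bullet> x = c})"

definition face_with_interior_point :: "real ^ 'n ^ 'b \<Rightarrow> (real ^ 'b::finite) set \<Rightarrow> bool" where
  "face_with_interior_point B F \<longleftrightarrow>
     F face_of eigenpolytope B \<and> aff_dim F \<ge> 1 \<and> (\<exists>i. column i B \<in> rel_interior F)"

end

theory Submission
  imports Defs
begin

text \<open>
  For a vertex \<open>j\<close> other than the first, the vector with entry 1 before \<open>j\<close>, entry
  \<open>-(j - 1)\<close> at \<open>j\<close> and 0 after \<open>j\<close> is a Laplacian eigenvector; these vectors and the constant one
  form an orthogonal eigenbasis, and those of \<open>i\<close> and \<open>j\<close> share an eigenvalue iff \<open>i\<close> and \<open>j\<close> lie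
  in the same type run. Let \<open>T\<close> consist of the vertices whose eigenvector lies in one of
  \<open>E\<^sub>t\<^sub>+\<^sub>1, ..., E\<^sub>k\<close>. Being orthogonal to the eigenvectors of all other vertices
  means that the entry at each vertex \<open>j\<close> outside \<open>T\<close> is the mean
  of the entries before it. Such averaging vectors are determined by arbitrary values at \<open>T\<close> and the
  first vertex. On the one hand they are the affine functions on the eigenconfiguration, so the points
  indexed by \<open>T\<close> and the first vertex span a simplex containing all the others; on the other hand, when
  their entries sum to 1 they are exactly the weights of designs of strength \<open>t\<close>.

  Some \<open>j \<notin> T\<close> comes after some \<open>i \<in> T\<close>; its point has at least two positive barycentric coordinates.
  A uniform design gives an affine function with two values, the extreme ones, so it is constant on every
  face with a configuration point in its relative interior. The barycentric coordinate of the first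
  vertex takes a value strictly between 0 and 1 at \<open>j\<close>: it yields both the facet normal that is not a
  2-witness direction and, after normalisation, the minimal positive design \<open>- T\<close>.
\<close>

section \<open>Laplacian spectrum of a threshold graph\<close>

lemma first_vertex_le: "first_vertex \<le> (v :: 'n::{finite,linorder})"
  unfolding first_vertex_def by simp

lemma first_vertex_less: "v \<noteq> first_vertex \<Longrightarrow> first_vertex < (v :: 'n::{finite,linorder})"
  using first_vertex_le[of v] by simp

text \<open>Stated as a well-founded relation because both the induction rule and the recursive
  construction of averaging vectors rest on it.\<close>

lemma wf_vertex_less: "wf {(u, v :: 'n::{finite,linorder}). u < v}"
proof (rule wf_subset)
  show "wf (Wellfounded.measure (\<lambda>v :: 'n. card {..<v}))" by simp
  show "{(u, v :: 'n). u < v} \<subseteq> Wellfounded.measure (\<lambda>v. card {..<v})"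
    by (auto intro!: psubset_card_mono)
qed

lemma vertex_less_induct [case_names less]:
  fixes v :: "'n::{finite,linorder}"
  assumes "\<And>v. (\<And>u. u < v \<Longrightarrow> P u) \<Longrightarrow> P v"
  shows "P v"
  using wf_vertex_less by (induction v rule: wf_induct_rule) (auto intro: assms)

text \<open>In difference form, neighbours with equal entries contribute nothing, which makes the
  constant vector and \<open>threshold_vector j\<close> easy to evaluate.\<close>

lemma laplacian_mult_component:
  assumes "irreflp adj"
  shows "(laplacian adj *v x) $ i = (\<Sum>u | adj i u. x $ i - x $ u)"
proof -
  have "(laplacian adj *v x) $ i
      = (\<Sum>u\<in>UNIV. (if i = u then real (degree adj i) * x $ i else 0)
          + (if adj i u then - x $ u else 0))"
    unfolding laplacian_def matrix_vector_mult_def using irreflpD[OF assms]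
    by (auto intro!: sum.cong)
  also have "\<dots> = real (degree adj i) * x $ i - (\<Sum>u | adj i u. x $ u)"
    by (simp add: sum.distrib sum.inter_filter[symmetric] sum_negf)
  also have "\<dots> = (\<Sum>u | adj i u. x $ i - x $ u)"
    by (simp add: degree_def sum_subtractf)
  finally show ?thesis .
qed

lemma laplacian_mult_one:
  assumes "irreflp adj"
  shows "laplacian adj *v 1 = 0"
  by (simp add: vec_eq_iff laplacian_mult_component[OF assms])

lemma laplacian_self_adjoint:
  assumes "symp adj"
  shows "(laplacian adj *v x) \<bullet> y = x \<bullet> (laplacian adj *v y)"
proof -
  have "transpose (laplacian adj) = laplacian adj"
    using sympD[OF assms] by (auto simp: transpose_def laplacian_def vec_eq_iff)
  then show ?thesis
    by (metis dot_lmul_matrix vector_transpose_matrix)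
qed

lemma laplacian_eigenvectors_orthogonal:
  assumes "symp adj" "laplacian adj *v x = l *\<^sub>R x" "laplacian adj *v y = m *\<^sub>R y" "l \<noteq> m"
  shows "x \<bullet> y = 0"
  using laplacian_self_adjoint[OF assms(1), of x y] assms(2-4) by simp

text \<open>For \<open>first_vertex\<close> the formula gives the zero vector, so eigenvectors come
  only from the other vertices.\<close>

definition threshold_vector :: "'n::{finite,linorder} \<Rightarrow> real ^ 'n::{finite,linorder}" where
  "threshold_vector j =
     (\<chi> u. if u < j then 1 else if u = j then - real (card {..<j}) else 0)"

text \<open>The eigenvalue of \<open>threshold_vector j\<close>: seen from an entry 1 before
  \<open>j\<close>, a dominating \<open>j\<close> contributes the difference
  \<open>1 + card {..<j}\<close>, that is \<open>card {..j}\<close>, and every later dominating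
  vertex contributes 1.\<close>

definition threshold_value :: "('n::{finite,linorder} \<Rightarrow> 'n \<Rightarrow> bool) \<Rightarrow> 'n \<Rightarrow> nat" where
  "threshold_value adj j =
     (if dominating adj j then card {..j} else 0) + card {u. j < u \<and> dominating adj u}"

lemma sum_UNIV_linorder:
  fixes j :: "'n::{finite,linorder}" and f :: "'n \<Rightarrow> 'a::comm_monoid_add"
  shows "sum f UNIV = sum f {..<j} + f j + sum f {j<..}"
proof -
  have "(UNIV :: 'n set) = insert j ({..<j} \<union> {j<..})" by auto
  then have "sum f UNIV = sum f (insert j ({..<j} \<union> {j<..}))" by simp
  also have "\<dots> = f j + sum f ({..<j} \<union> {j<..})"
    by (subst sum.insert) auto
  also have "sum f ({..<j} \<union> {j<..}) = sum f {..<j} + sum f {j<..}"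
    by (subst sum.union_disjoint) auto
  finally show ?thesis by (simp add: ac_simps)
qed

lemma inner_threshold_vector:
  "threshold_vector j \<bullet> x = (\<Sum>u<j. x $ u) - real (card {..<j}) * x $ j"
proof -
  have "threshold_vector j \<bullet> x = (\<Sum>u\<in>UNIV. threshold_vector j $ u * x $ u)"
    by (simp add: inner_vec_def)
  also have "\<dots> = (\<Sum>u<j. threshold_vector j $ u * x $ u) + threshold_vector j $ j * x $ j
      + (\<Sum>u\<in>{j<..}. threshold_vector j $ u * x $ u)"
    by (rule sum_UNIV_linorder)
  also have "(\<Sum>u\<in>{j<..}. threshold_vector j $ u * x $ u) = 0"
    by (intro sum.neutral) (auto simp: threshold_vector_def)
  also have "(\<Sum>u<j. threshold_vector j $ u * x $ u) = (\<Sum>u<j. x $ u)"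
    by (intro sum.cong) (auto simp: threshold_vector_def)
  also have "threshold_vector j $ j = - real (card {..<j})"
    by (simp add: threshold_vector_def)
  finally show ?thesis by simp
qed

lemma inner_one: "(1 :: real ^ 'n::finite) \<bullet> x = (\<Sum>u\<in>UNIV. x $ u)"
  by (simp add: inner_vec_def)

lemma card_lessThan_pos: "j \<noteq> first_vertex \<Longrightarrow> 0 < card {..<j :: 'n::{finite,linorder}}"
  using first_vertex_less by (auto simp: card_gt_0_iff)

lemma threshold_vector_nonzero: "j \<noteq> first_vertex \<Longrightarrow> threshold_vector j \<noteq> 0"
  using first_vertex_less[of j] by (auto simp: threshold_vector_def vec_eq_iff)

text \<open>The support of \<open>threshold_vector i\<close> lies before \<open>j\<close>, where
  \<open>threshold_vector j\<close> is constant, and its entries cancel.\<close>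

lemma threshold_vector_orthogonal:
  fixes i j :: "'n::{finite,linorder}"
  assumes "i < j"
  shows "threshold_vector j \<bullet> threshold_vector i = 0"
proof -
  have "(\<Sum>u<j. threshold_vector i $ u) = (\<Sum>u\<in>insert i {..<i}. threshold_vector i $ u)"
    using assms by (intro sum.mono_neutral_right) (auto simp: threshold_vector_def)
  also have "\<dots> = 0" by (subst sum.insert) (auto simp: threshold_vector_def)
  finally have "(\<Sum>u<j. threshold_vector i $ u) = 0" .
  moreover have "threshold_vector i $ j = 0"
    using assms by (auto simp: threshold_vector_def)
  ultimately show ?thesis
    unfolding inner_threshold_vector by simp
qed

text \<open>Completeness of the eigenbasis without a dimension count: an entry that is always the
  mean of its predecessors never changes, and a constant vector with sum 0 vanishes.\<close>

lemma orthogonal_threshold_vectors_imp_zero: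
  fixes x :: "real ^ 'n::{finite,linorder}"
  assumes one: "1 \<bullet> x = 0"
    and vec: "\<And>j. j \<noteq> first_vertex \<Longrightarrow> threshold_vector j \<bullet> x = 0"
  shows "x = 0"
proof -
  have const: "x $ j = x $ first_vertex" for j
  proof (induction j rule: vertex_less_induct)
    case (less j)
    show ?case
    proof (cases "j = first_vertex")
      case False
      have "(\<Sum>u<j. x $ u) = real (card {..<j}) * x $ first_vertex"
        using less by simp
      then show ?thesis
        using vec[OF False] card_lessThan_pos[OF False] by (auto simp: inner_threshold_vector)
    qed simp
  qed
  have "(\<Sum>u\<in>UNIV. x $ u) = (\<Sum>u\<in>(UNIV :: 'n set). x $ first_vertex)"
    by (intro sum.cong refl const)
  then have "x $ first_vertex = 0"
    using one by (simp add: inner_one)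
  then have "x $ j = 0" for j
    using const[of j] by simp
  then show ?thesis by (simp add: vec_eq_iff)
qed

locale connected_threshold_graph =
  fixes adj :: "'n::{finite,linorder} \<Rightarrow> 'n \<Rightarrow> bool"
  assumes threshold: "threshold_graph adj" and connected: "connected_graph adj"
begin

lemma adj_sym: "symp adj" and adj_irrefl: "irreflp adj"
  using threshold by (auto simp: threshold_graph_def)

lemma dominating_or_isolated: "dominating adj i \<or> isolated adj i"
  using threshold by (auto simp: threshold_graph_def)

lemma not_dominating_isolated:
  "i \<noteq> first_vertex \<Longrightarrow> isolated adj i \<longleftrightarrow> \<not> dominating adj i"
  using dominating_or_isolated[of i] first_vertex_less[of i]
  by (auto simp: dominating_def isolated_def)

lemma adj_iff_dominating: "u < v \<Longrightarrow> adj u v \<longleftrightarrow> dominating adj v" "u < v \<Longrightarrow> adj v u \<longleftrightarrow> dominating adj v"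
  using dominating_or_isolated[of v] sympD[OF adj_sym, of u v] sympD[OF adj_sym, of v u]
  by (auto simp: dominating_def isolated_def)

lemma one_orthogonal_eigenvector:
  assumes "laplacian adj *v x = l *\<^sub>R x" "l \<noteq> 0"
  shows "1 \<bullet> x = 0"
proof (rule laplacian_eigenvectors_orthogonal[OF adj_sym _ assms(1)])
  show "laplacian adj *v 1 = 0 *\<^sub>R 1"
    using laplacian_mult_one[OF adj_irrefl] by simp
qed (use assms(2) in simp)

lemma not_adj_self: "\<not> adj i i"
  using irreflpD[OF adj_irrefl] .

lemma laplacian_threshold_vector:
  assumes "j \<noteq> first_vertex"
  shows "laplacian adj *v threshold_vector j = real (threshold_value adj j) *\<^sub>R threshold_vector j"
proof -
  let ?x = "threshold_vector j" and ?r = "card {..<j}" and ?D = "{u. j < u \<and> dominating adj u}"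
  have x: "?x $ u = (if u < j then 1 else if u = j then - real ?r else 0)" for u
    by (simp add: threshold_vector_def)
  \<comment> \<open>Entries after \<open>j\<close> are 0, so each later dominating vertex
    contributes the full entry at \<open>i\<close>; this is the second summand of
    \<open>threshold_value\<close>.\<close>
  have above: "(\<Sum>u\<in>{j<..}. if adj i u then ?x $ i - ?x $ u else 0) = real (card ?D) * ?x $ i"
    if "i \<le> j" for i
  proof -
    have "(\<Sum>u\<in>{j<..}. if adj i u then ?x $ i - ?x $ u else 0)
        = (\<Sum>u\<in>{j<..}. if dominating adj u then ?x $ i else 0)"
      using that by (intro sum.cong) (auto simp: x adj_iff_dominating)
    also have "\<dots> = (\<Sum>u | u \<in> {j<..} \<and> dominating adj u. ?x $ i)"
      by (simp add: sum.inter_filter[symmetric])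
    finally show ?thesis by simp
  qed
  have card_atMost: "card {..j} = Suc ?r"
    by (simp add: lessThan_Suc_atMost[symmetric] ivl_disj_un(2)[symmetric])
  show ?thesis
  proof (rule vec_eq_iff[THEN iffD2], rule allI)
    fix i
    have "(laplacian adj *v ?x) $ i = (\<Sum>u\<in>UNIV. if adj i u then ?x $ i - ?x $ u else 0)"
      by (simp add: laplacian_mult_component[OF adj_irrefl] sum.inter_filter[symmetric])
    also have "\<dots> = real (threshold_value adj j) * ?x $ i"
    proof (cases i j rule: linorder_cases)
      case less
      have "(\<Sum>u<j. if adj i u then ?x $ i - ?x $ u else 0) = 0"
        using less by (intro sum.neutral) (auto simp: x)
      then show ?thesis
        using less above[of i] card_atMost
        by (subst sum_UNIV_linorder[of _ j])
           (auto simp: x adj_iff_dominating threshold_value_def algebra_simps)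
    next
      case equal
      have "(\<Sum>u<j. if adj i u then ?x $ i - ?x $ u else 0)
          = (if dominating adj j then real ?r * (- real ?r - 1) else 0)"
        using equal by (simp add: x adj_iff_dominating)
      then show ?thesis
        using equal above[of i] card_atMost not_adj_self
        by (subst sum_UNIV_linorder[of _ j])
           (auto simp: x threshold_value_def algebra_simps)
    next
      case greater
      \<comment> \<open>Here the entry at \<open>i\<close> is 0. For dominating \<open>i\<close> the
        entries 1 before \<open>j\<close> contribute \<open>- ?r\<close> in total, which cancels
        against the entry \<open>- ?r\<close> at \<open>j\<close>.\<close>
      have 1: "(\<Sum>u<j. if adj i u then ?x $ i - ?x $ u else 0)
          = (if dominating adj i then - real ?r else 0)"
        using greater by (simp add: x adj_iff_dominating)
      have 2: "(\<Sum>u\<in>{j<..}. if adj i u then ?x $ i - ?x $ u else 0) = 0"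
        using greater by (intro sum.neutral) (auto simp: x)
      show ?thesis
        using greater 1 2
        by (subst sum_UNIV_linorder[of _ j]) (auto simp: x adj_iff_dominating)
    qed
    finally show "(laplacian adj *v ?x) $ i = (real (threshold_value adj j) *\<^sub>R ?x) $ i"
      by simp
  qed
qed

text \<open>Connectivity enters here: a zero value means that neither \<open>j\<close> nor any later
  vertex dominates, which leaves \<open>j\<close> without neighbours.\<close>

lemma threshold_value_pos:
  assumes "j \<noteq> first_vertex"
  shows "threshold_value adj j > 0"
proof (rule ccontr)
  assume "\<not> ?thesis"
  then have zero: "threshold_value adj j = 0" by simp
  then have nd: "\<not> dominating adj j"
    by (auto simp: threshold_value_def)
  have none: "\<not> dominating adj u" if "j < u" for u
    using zero that by (auto simp: threshold_value_def)
  have "\<not> adj j u" for u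
    using nd none[of u] not_adj_self adj_iff_dominating[of u j] adj_iff_dominating[of j u]
    by (cases u j rule: linorder_cases) auto
  moreover have "adj\<^sup>*\<^sup>* j first_vertex"
    using connected by (auto simp: connected_graph_def)
  ultimately show False
    using assms by (metis converse_rtranclpE)
qed

text \<open>An eigenvector for any further value would be orthogonal to the whole eigenbasis, hence
  zero.\<close>

lemma eigenvalues_laplacian:
  "eigenvalues (laplacian adj) = insert 0 (threshold_value adj ` (- {first_vertex}))" (is "?E = ?S")
proof
  have "(0::real) \<in> ?E"
    unfolding eigenvalues_def using laplacian_mult_one[OF adj_irrefl] by (auto intro!: exI[of _ 1])
  moreover have "real (threshold_value adj j) \<in> ?E" if "j \<noteq> first_vertex" for j
    unfolding eigenvalues_def
    using laplacian_threshold_vector[OF that] threshold_vector_nonzero[OF that] by auto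
  ultimately show "?S \<subseteq> ?E" by auto
  show "?E \<subseteq> ?S"
  proof
    fix l assume "l \<in> ?E"
    then obtain x where x: "x \<noteq> 0" "laplacian adj *v x = l *\<^sub>R x"
      by (auto simp: eigenvalues_def)
    show "l \<in> ?S"
    proof (rule ccontr)
      assume l: "l \<notin> ?S"
      have "1 \<bullet> x = 0"
        using one_orthogonal_eigenvector[OF x(2)] l by simp
      moreover have "threshold_vector j \<bullet> x = 0" if "j \<noteq> first_vertex" for j
      proof -
        have "real (threshold_value adj j) \<noteq> l" using l that by auto
        then show ?thesis
          using laplacian_eigenvectors_orthogonal[OF adj_sym laplacian_threshold_vector[OF that] x(2)]
          by simp
      qed
      ultimately show False
        using orthogonal_threshold_vectors_imp_zero x(1) by blast
    qed
  qed
qed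

text \<open>The part of \<open>x\<close> orthogonal to the span is orthogonal to the whole
  eigenbasis, so it vanishes. The set \<open>\<Lambda>\<close> selects eigenvalues: a singleton for
  one eigenspace, all values above a bound for the sum of the top ones.\<close>

lemma in_span_threshold_vectors:
  assumes "1 \<bullet> x = 0"
    and "\<And>j. j \<noteq> first_vertex \<Longrightarrow> threshold_value adj j \<notin> \<Lambda> \<Longrightarrow> threshold_vector j \<bullet> x = 0"
  shows "x \<in> span (threshold_vector ` {j. j \<noteq> first_vertex \<and> threshold_value adj j \<in> \<Lambda>})"
    (is "x \<in> span ?S")
proof -
  obtain y z where y: "y \<in> span ?S" and z: "\<And>w. w \<in> span ?S \<Longrightarrow> orthogonal z w"
    and xyz: "x = y + z"
    using orthogonal_subspace_decomp_exists[of ?S x] by blast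
  have orth: "w \<bullet> y = 0" if w: "\<And>s. s \<in> ?S \<Longrightarrow> w \<bullet> s = 0" for w
  proof -
    have "span ?S \<subseteq> {y. w \<bullet> y = 0}"
      using w by (intro span_minimal subspace_hyperplane) auto
    then show ?thesis using y by auto
  qed
  have "1 \<bullet> y = 0"
  proof (rule orth)
    fix s assume "s \<in> ?S"
    then obtain j where "j \<noteq> first_vertex" "s = threshold_vector j" by auto
    then show "1 \<bullet> s = 0"
      using one_orthogonal_eigenvector[OF laplacian_threshold_vector[of j]] threshold_value_pos[of j]
      by simp
  qed
  then have "1 \<bullet> z = 0"
    using assms(1) xyz by (simp add: inner_add_right)
  moreover have "threshold_vector j \<bullet> z = 0" if j: "j \<noteq> first_vertex" for j
  proof (cases "threshold_value adj j \<in> \<Lambda>")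
    case True
    then show ?thesis
      using j z[OF span_base[of "threshold_vector j" ?S]] by (auto simp: orthogonal_def inner_commute)
  next
    case False
    have "threshold_vector j \<bullet> y = 0"
    proof (rule orth)
      fix s assume "s \<in> ?S"
      then obtain i where i: "i \<noteq> first_vertex" "threshold_value adj i \<in> \<Lambda>"
        "s = threshold_vector i" by auto
      have "real (threshold_value adj j) \<noteq> real (threshold_value adj i)"
        using i(2) False by auto
      then show "threshold_vector j \<bullet> s = 0"
        using laplacian_eigenvectors_orthogonal[OF adj_sym laplacian_threshold_vector[OF j]
          laplacian_threshold_vector[OF i(1)]] i(3) by simp
    qed
    then show ?thesis
      using assms(2)[OF j False] xyz by (simp add: inner_add_right)
  qed
  ultimately have "z = 0"
    by (rule orthogonal_threshold_vectors_imp_zero)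
  then show ?thesis using xyz y by simp
qed

lemma eigenspace_eq_span:
  assumes "0 < l"
  shows "{x. laplacian adj *v x = real l *\<^sub>R x}
    = span (threshold_vector ` {j. j \<noteq> first_vertex \<and> threshold_value adj j = l})"
proof
  show "{x. laplacian adj *v x = real l *\<^sub>R x}
    \<subseteq> span (threshold_vector ` {j. j \<noteq> first_vertex \<and> threshold_value adj j = l})"
  proof
    fix x assume "x \<in> {x. laplacian adj *v x = real l *\<^sub>R x}"
    then have x: "laplacian adj *v x = real l *\<^sub>R x" by simp
    have "1 \<bullet> x = 0"
      using one_orthogonal_eigenvector[OF x] assms by simp
    moreover have "threshold_vector j \<bullet> x = 0"
      if "j \<noteq> first_vertex" "threshold_value adj j \<notin> {l}" for j
    proof -
      have "real (threshold_value adj j) \<noteq> real l" using that by simp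
      then show ?thesis
        using laplacian_eigenvectors_orthogonal[OF adj_sym laplacian_threshold_vector[OF that(1)] x]
        by simp
    qed
    ultimately show "x \<in> span (threshold_vector ` {j. j \<noteq> first_vertex \<and> threshold_value adj j = l})"
      using in_span_threshold_vectors[of x "{l}"] by simp
  qed
next
  have "subspace {x. laplacian adj *v x = real l *\<^sub>R x}"
    by (auto simp: subspace_def matrix_vector_right_distrib matrix_vector_mult_scaleR
        scaleR_add_right)
  then show "span (threshold_vector ` {j. j \<noteq> first_vertex \<and> threshold_value adj j = l})
      \<subseteq> {x. laplacian adj *v x = real l *\<^sub>R x}"
    by (intro span_minimal) (auto simp: laplacian_threshold_vector)
qed

lemma dim_eigenspace:
  assumes "0 < l"
  shows "dim {x. laplacian adj *v x = real l *\<^sub>R x}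
    = card {j. j \<noteq> first_vertex \<and> threshold_value adj j = l}"
proof -
  let ?J = "{j. j \<noteq> first_vertex \<and> threshold_value adj j = l}"
  have orth: "threshold_vector i \<bullet> threshold_vector j = 0" if "i \<noteq> j" for i j :: 'n
    using that threshold_vector_orthogonal[of i j] threshold_vector_orthogonal[of j i]
    by (cases i j rule: linorder_cases) (auto simp: inner_commute)
  have nz: "threshold_vector i \<noteq> 0" if "i \<in> ?J" for i
    using that threshold_vector_nonzero by auto
  have "inj_on threshold_vector ?J"
  proof (rule inj_onI, rule ccontr)
    fix i j
    assume ij: "i \<in> ?J" "threshold_vector i = threshold_vector j" "i \<noteq> j"
    then have "threshold_vector i \<bullet> threshold_vector i = 0" using orth[OF ij(3)] by simp
    then show False using nz[OF ij(1)] by simp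
  qed
  moreover have "independent (threshold_vector ` ?J)"
  proof (intro pairwise_orthogonal_independent)
    show "pairwise orthogonal (threshold_vector ` ?J)"
      by (auto simp: pairwise_def orthogonal_def intro!: orth)
    show "0 \<notin> threshold_vector ` ?J"
      using nz by force
  qed
  ultimately show ?thesis
    by (simp add: eigenspace_eq_span[OF assms] dim_eq_card_independent card_image)
qed

end

section \<open>Type runs and distinct eigenvalues\<close>

context connected_threshold_graph
begin

lemma card_above_split:
  assumes "u < v"
  shows "card {w. u < w \<and> dominating adj w}
    = card {w \<in> {u<..v}. dominating adj w} + card {w. v < w \<and> dominating adj w}"
proof -
  have "{w. u < w \<and> dominating adj w}
      = {w \<in> {u<..v}. dominating adj w} \<union> {w. v < w \<and> dominating adj w}"
    using assms by auto
  moreover have "{w \<in> {u<..v}. dominating adj w} \<inter> {w. v < w \<and> dominating adj w} = {}"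
    by auto
  ultimately show ?thesis by (simp only: card_Un_disjoint finite)
qed

lemma card_atMost_split:
  fixes u v :: 'n
  assumes "u < v"
  shows "card {..v} = card {..u} + card {u<..v}"
proof -
  have "{..v} = {..u} \<union> {u<..v}" using assms by auto
  moreover have "{..u} \<inter> {u<..v} = {}" by auto
  ultimately show ?thesis by (simp only: card_Un_disjoint finite)
qed

text \<open>The value at a non-dominating \<open>v\<close> counts only later dominating vertices,
  and all of these count at \<open>u\<close> too.\<close>

lemma threshold_value_antimono:
  assumes "u < v" "\<not> dominating adj v"
  shows "threshold_value adj v \<le> threshold_value adj u"
  using assms by (simp add: threshold_value_def card_above_split)

text \<open>This links eigenvalues to runs. Starting after the first vertex keeps the two types
  exclusive on the whole interval.\<close>

lemma threshold_value_eq_iff: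
  assumes "u < v" "u \<noteq> first_vertex"
  shows "threshold_value adj u = threshold_value adj v
    \<longleftrightarrow> (\<forall>w\<in>{u..v}. dominating adj w) \<or> (\<forall>w\<in>{u..v}. isolated adj w)"
proof -
  let ?X = "{w \<in> {u<..v}. dominating adj w}"
  have interval: "{u..v} = insert u {u<..v}" using assms by auto
  have iso: "isolated adj w \<longleftrightarrow> \<not> dominating adj w" if "w \<in> {u..v}" for w
    using that first_vertex_less[OF assms(2)] by (intro not_dominating_isolated) auto
  have le: "card ?X \<le> card {u<..v}" by (intro card_mono) auto
  have full: "card ?X = card {u<..v} \<longleftrightarrow> (\<forall>w\<in>{u<..v}. dominating adj w)"
  proof
    assume "card ?X = card {u<..v}"
    then have "?X = {u<..v}" by (intro card_subset_eq) auto
    then show "\<forall>w\<in>{u<..v}. dominating adj w" by blast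
  next
    assume "\<forall>w\<in>{u<..v}. dominating adj w"
    then have "?X = {u<..v}" by blast
    then show "card ?X = card {u<..v}" by simp
  qed
  have empty: "card ?X = 0 \<longleftrightarrow> (\<forall>w\<in>{u<..v}. \<not> dominating adj w)"
    by auto
  have pos: "card {..u} > 0" by (auto simp: card_gt_0_iff)
  have v: "v \<in> {u<..v}" using assms by simp
  \<comment> \<open>Dominating vertices after \<open>v\<close> cancel. For dominating
    \<open>v\<close> there remains \<open>card {..u} + card {u<..v}\<close>, which \<open>u\<close>
    matches only by attaining both summands in full; for other \<open>v\<close> both contributions
    at \<open>u\<close> must vanish.\<close>
  have "threshold_value adj u = threshold_value adj v
    \<longleftrightarrow> (if dominating adj v then dominating adj u \<and> card ?X = card {u<..v}
        else \<not> dominating adj u \<and> card ?X = 0)"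
    using le pos
    by (auto simp: threshold_value_def card_above_split[OF assms(1)] card_atMost_split[OF assms(1)])
  also have "\<dots> \<longleftrightarrow> (\<forall>w\<in>{u..v}. dominating adj w) \<or> (\<forall>w\<in>{u..v}. \<not> dominating adj w)"
    unfolding full empty interval using v by auto
  finally show ?thesis using iso by simp
qed

lemma type_run_threshold_value_eq:
  assumes R: "type_run adj R" and "u \<in> R" "v \<in> R"
  shows "threshold_value adj u = threshold_value adj v"
proof -
  have less: "threshold_value adj u = threshold_value adj v" if "u \<in> R" "v \<in> R" "u < v" for u v
  proof -
    have "{u..v} \<subseteq> R" "u \<noteq> first_vertex" using R that by (auto simp: type_run_def)
    moreover have "(\<forall>w\<in>{u..v}. dominating adj w) \<or> (\<forall>w\<in>{u..v}. isolated adj w)"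
      using R \<open>{u..v} \<subseteq> R\<close> unfolding type_run_def by blast
    ultimately show ?thesis using threshold_value_eq_iff[OF that(3)] by blast
  qed
  show ?thesis
  proof (cases u v rule: linorder_cases)
    case greater
    then show ?thesis using less[OF assms(3,2)] by simp
  qed (use less[OF assms(2,3)] in simp_all)
qed

text \<open>The stretch between two vertices of equal value has a single type, so all values on it
  agree and the fibre is an interval.\<close>

lemma type_run_fibre:
  assumes "v \<noteq> first_vertex"
  shows "type_run adj {w. w \<noteq> first_vertex \<and> threshold_value adj w = threshold_value adj v}"
    (is "type_run adj ?R")
proof -
  have const: "(\<forall>y\<in>{u..w}. dominating adj y) \<or> (\<forall>y\<in>{u..w}. isolated adj y)"
    if "u \<in> ?R" "w \<in> ?R" "u < w" for u w
  proof -
    have "u \<noteq> first_vertex" "threshold_value adj u = threshold_value adj w"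
      using that by simp_all
    then show ?thesis by (rule iffD1[OF threshold_value_eq_iff[OF that(3)]])
  qed
  have between: "threshold_value adj x = threshold_value adj v"
    if "u \<in> ?R" "w \<in> ?R" "x \<in> {u..w}" for u w x
  proof (cases "u = x")
    case True
    then show ?thesis using that(1) by simp
  next
    case False
    then have *: "u < x" "u < w" "{u..x} \<subseteq> {u..w}" using that(3) by auto
    have u: "u \<noteq> first_vertex" "threshold_value adj u = threshold_value adj v"
      using that(1) by simp_all
    have "(\<forall>y\<in>{u..x}. dominating adj y) \<or> (\<forall>y\<in>{u..x}. isolated adj y)"
      using const[OF that(1,2) *(2)] *(3) by blast
    then have "threshold_value adj u = threshold_value adj x"
      by (simp only: threshold_value_eq_iff[OF *(1) u(1)])
    then show ?thesis using u(2) by simp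
  qed
  have same: "dominating adj u \<longleftrightarrow> dominating adj w" if "u \<in> ?R" "w \<in> ?R" "u < w" for u w
  proof -
    have "u \<in> {u..w}" "w \<in> {u..w}" using that(3) by auto
    then have "dominating adj u \<and> dominating adj w \<or> isolated adj u \<and> isolated adj w"
      using const[OF that] by blast
    moreover have "u \<noteq> first_vertex" "w \<noteq> first_vertex" using that by simp_all
    ultimately show ?thesis using not_dominating_isolated by blast
  qed
  have type: "dominating adj u \<longleftrightarrow> dominating adj v" if "u \<in> ?R" for u
  proof (cases u v rule: linorder_cases)
    case less
    then show ?thesis using same[OF that] assms by blast
  next
    case greater
    then show ?thesis using same[OF _ that] assms by blast
  qed simp
  have "(\<forall>u\<in>?R. dominating adj u) \<or> (\<forall>u\<in>?R. isolated adj u)"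
  proof (cases "dominating adj v")
    case True
    then show ?thesis using type by blast
  next
    case False
    then have "isolated adj u" if "u \<in> ?R" for u
      using type[OF that] not_dominating_isolated[of u] that by simp
    then show ?thesis by blast
  qed
  moreover have "{u..w} \<subseteq> ?R" if "u \<in> ?R" "w \<in> ?R" for u w
  proof
    fix x assume x: "x \<in> {u..w}"
    then have "x \<noteq> first_vertex" using that first_vertex_less[of u] by auto
    then show "x \<in> ?R" using between[OF that x] by simp
  qed
  moreover have "v \<in> ?R" using assms by simp
  ultimately show ?thesis
    unfolding type_run_def by blast
qed

text \<open>Every run lies inside a fibre of \<open>threshold_value\<close>, and the fibres are
  themselves runs.\<close>

lemma maximal_type_run_iff_fibre:
  "maximal_type_run adj R \<longleftrightarrow> (\<exists>v. v \<noteq> first_vertex \<and>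
     R = {w. w \<noteq> first_vertex \<and> threshold_value adj w = threshold_value adj v})"
proof -
  have sub: "R \<subseteq> {w. w \<noteq> first_vertex \<and> threshold_value adj w = threshold_value adj v}"
    if "type_run adj R" "v \<in> R" for R v
    using type_run_threshold_value_eq[OF that(1) _ that(2)] that(1) by (auto simp: type_run_def)
  show ?thesis
  proof
    assume R: "maximal_type_run adj R"
    then obtain v where "v \<in> R" "v \<noteq> first_vertex" "type_run adj R"
      by (auto simp: maximal_type_run_def type_run_def)
    then have "R = {w. w \<noteq> first_vertex \<and> threshold_value adj w = threshold_value adj v}"
      using R sub[of R v] type_run_fibre[of v] unfolding maximal_type_run_def by blast
    with \<open>v \<noteq> first_vertex\<close> show "\<exists>v. v \<noteq> first_vertex \<and>
        R = {w. w \<noteq> first_vertex \<and> threshold_value adj w = threshold_value adj v}"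
      by blast
  next
    assume "\<exists>v. v \<noteq> first_vertex \<and>
        R = {w. w \<noteq> first_vertex \<and> threshold_value adj w = threshold_value adj v}"
    then obtain v where v: "v \<noteq> first_vertex"
      and R: "R = {w. w \<noteq> first_vertex \<and> threshold_value adj w = threshold_value adj v}" by blast
    have "R' = R" if "type_run adj R'" "R \<subseteq> R'" for R'
    proof -
      have "v \<in> R'" using that(2) v R by blast
      then have "R' \<subseteq> R" using sub[OF that(1)] R by blast
      then show ?thesis using that(2) by blast
    qed
    then show "maximal_type_run adj R"
      using type_run_fibre[OF v] unfolding R[symmetric] maximal_type_run_def by blast
  qed
qed

lemma card_maximal_type_runs:
  "card {R. maximal_type_run adj R} = card (threshold_value adj ` (- {first_vertex}))"
proof -
  let ?fibre = "\<lambda>l. {w. w \<noteq> first_vertex \<and> threshold_value adj w = l}"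
  have "{R. maximal_type_run adj R} = ?fibre ` threshold_value adj ` (- {first_vertex})"
    unfolding maximal_type_run_iff_fibre by blast
  moreover have "inj_on ?fibre (threshold_value adj ` (- {first_vertex}))"
  proof (rule inj_onI)
    fix l m
    assume "l \<in> threshold_value adj ` (- {first_vertex})" and eq: "?fibre l = ?fibre m"
    then obtain v where "v \<in> ?fibre l" by auto
    then have "v \<in> ?fibre l" "v \<in> ?fibre m" using eq by simp_all
    then show "l = m" by simp
  qed
  ultimately show ?thesis by (simp add: card_image)
qed

end

section \<open>Indexing the distinct eigenvalues and splitting the vertices at strength t\<close>

locale threshold_design = connected_threshold_graph adj
  for adj :: "'n::{finite,linorder} \<Rightarrow> 'n \<Rightarrow> bool" +
  fixes I :: "nat \<Rightarrow> 'n::{finite,linorder} set" and k t :: nat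
  assumes intervals: "type_intervals adj k I" and t: "1 \<le> t" "t \<le> k - 2"
begin

text \<open>Since \<open>1 \<le> t\<close>, the natural-number subtraction in
  \<open>t \<le> k - 2\<close> is not truncated.\<close>

lemma t_le: "t + 2 \<le> k" using t by auto

text \<open>The nonzero eigenvalues correspond to the \<open>k\<close> maximal runs, and their
  positivity keeps 0 separate from them.\<close>

lemma card_eigenvalues: "card (eigenvalues (laplacian adj)) = k + 1"
proof -
  have "card (threshold_value adj ` (- {first_vertex})) = k"
    using intervals bij_betw_same_card[of I "{1..k}"] card_maximal_type_runs
    by (auto simp: type_intervals_def)
  moreover have "inj_on real A" for A by (auto intro: inj_onI)
  ultimately have "card (real ` threshold_value adj ` (- {first_vertex})) = k"
    by (simp add: card_image)
  moreover have "0 \<notin> real ` threshold_value adj ` (- {first_vertex})"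
    using threshold_value_pos by fastforce
  ultimately show ?thesis
    by (simp add: eigenvalues_laplacian image_image)
qed

lemma finite_eigenvalues: "finite (eigenvalues (laplacian adj))"
  by (simp add: eigenvalues_laplacian)

lemma lap_eigenvalue_less_iff:
  assumes "i \<le> k" "j \<le> k"
  shows "lap_eigenvalue adj i < lap_eigenvalue adj j \<longleftrightarrow> i < j"
proof -
  have "lap_eigenvalue adj i < lap_eigenvalue adj j" if "i < j" "j \<le> k" for i j
    unfolding lap_eigenvalue_def using that finite_eigenvalues card_eigenvalues
    by (intro sorted_wrt_nth_less[of "(<)"]) auto
  then show ?thesis
    using assms by (metis less_asym linorder_neqE_nat order_less_irrefl)
qed

lemma lap_eigenvalue_image: "lap_eigenvalue adj ` {0..k} = eigenvalues (laplacian adj)"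
proof -
  let ?xs = "sorted_list_of_set (eigenvalues (laplacian adj))"
  have "{0..k} = {0..<length ?xs}"
    using card_eigenvalues by auto
  moreover have "lap_eigenvalue adj = (!) ?xs"
    by (rule ext) (simp only: lap_eigenvalue_def)
  ultimately have "lap_eigenvalue adj ` {0..k} = (!) ?xs ` {0..<length ?xs}"
    by simp
  also have "\<dots> = set ?xs"
    by (simp add: nth_image)
  also have "\<dots> = eigenvalues (laplacian adj)"
    using finite_eigenvalues by simp
  finally show ?thesis .
qed

lemma lap_eigenvalue_0: "lap_eigenvalue adj 0 = 0"
proof -
  have "0 \<in> lap_eigenvalue adj ` {0..k}"
    by (simp add: lap_eigenvalue_image eigenvalues_laplacian)
  then obtain i where i: "i \<le> k" "lap_eigenvalue adj i = 0" by auto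
  have "lap_eigenvalue adj 0 \<in> eigenvalues (laplacian adj)"
    using lap_eigenvalue_image by auto
  then have "\<not> lap_eigenvalue adj 0 < 0"
    by (auto simp: eigenvalues_laplacian)
  then have "\<not> 0 < i"
    using i lap_eigenvalue_less_iff[of 0 i] by simp
  then show ?thesis using i(2) by simp
qed

lemma threshold_value_index:
  assumes "j \<noteq> first_vertex"
  obtains i where "i \<in> {1..k}" "real (threshold_value adj j) = lap_eigenvalue adj i"
proof -
  have "real (threshold_value adj j) \<in> lap_eigenvalue adj ` {0..k}"
    using assms by (simp add: lap_eigenvalue_image eigenvalues_laplacian)
  then obtain i where i: "i \<le> k" "real (threshold_value adj j) = lap_eigenvalue adj i" by auto
  moreover have "i \<noteq> 0"
  proof
    assume "i = 0"
    then have "real (threshold_value adj j) = 0" using i(2) lap_eigenvalue_0 by simp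
    then show False using threshold_value_pos[OF assms] by simp
  qed
  ultimately show ?thesis by (intro that[of i]) auto
qed

lemma lap_eigenvalue_attained:
  assumes "i \<in> {1..k}"
  obtains j where "j \<noteq> first_vertex" "real (threshold_value adj j) = lap_eigenvalue adj i"
proof -
  have "lap_eigenvalue adj i \<in> eigenvalues (laplacian adj)"
    using assms by (auto simp: lap_eigenvalue_image[symmetric])
  moreover have "lap_eigenvalue adj i \<noteq> 0"
    using assms lap_eigenvalue_less_iff[of 0 i] lap_eigenvalue_0 by auto
  ultimately obtain j where "j \<noteq> first_vertex" "lap_eigenvalue adj i = real (threshold_value adj j)"
    unfolding eigenvalues_laplacian by blast
  then show ?thesis by (intro that[of j]) simp_all
qed

text \<open>The set \<open>T\<close> of the introductory explanation.\<close>

definition top_vertices :: "'n set" where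
  "top_vertices = {j. j \<noteq> first_vertex \<and> lap_eigenvalue adj t < real (threshold_value adj j)}"

lemma first_not_top: "first_vertex \<notin> top_vertices"
  by (simp add: top_vertices_def)

text \<open>Otherwise the top vertices form a final segment. They must then all be dominating, so
  they share one eigenvalue, although at least two distinct eigenvalues lie above the one with index
  \<open>t\<close>.\<close>

lemma top_before_low: "\<exists>i j. i \<in> top_vertices \<and> j \<notin> top_vertices \<and> i < j"
proof (rule ccontr)
  assume "\<not> ?thesis"
  then have up: "j \<in> top_vertices" if "i \<in> top_vertices" "i < j" for i j
    using that by blast
  have k: "1 \<in> {1..k}" "k \<in> {1..k}" "k - 1 \<in> {1..k}" using t by auto
  \<comment> \<open>A vertex of the smallest positive eigenvalue; as \<open>1 \<le> t\<close>, it is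
    not a top vertex.\<close>
  obtain j where j: "j \<noteq> first_vertex" "real (threshold_value adj j) = lap_eigenvalue adj 1"
    using lap_eigenvalue_attained[OF k(1)] .
  have jt: "j \<notin> top_vertices"
    using j t t_le lap_eigenvalue_less_iff[of t 1] by (auto simp: top_vertices_def)
  have dom: "dominating adj m" if m: "m \<in> top_vertices" for m
  proof (rule ccontr)
    assume "\<not> dominating adj m"
    moreover have "j < m"
      using up[OF m, of j] jt m by (cases j m rule: linorder_cases) auto
    ultimately have "threshold_value adj m \<le> threshold_value adj j"
      by (intro threshold_value_antimono)
    then show False using m j jt by (auto simp: top_vertices_def)
  qed
  have eq: "threshold_value adj u = threshold_value adj v"
    if "u \<in> top_vertices" "v \<in> top_vertices" "u < v" for u v
  proof -
    have "w \<in> top_vertices" if "w \<in> {u..v}" for w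
      using that up[of u w] \<open>u \<in> top_vertices\<close> by (cases "w = u") auto
    then show ?thesis
      using dom that threshold_value_eq_iff[OF that(3)] by (auto simp: top_vertices_def)
  qed
  \<comment> \<open>By \<open>t + 2 \<le> k\<close> the two largest eigenvalues both have an index
    above \<open>t\<close>.\<close>
  obtain u v where u: "u \<noteq> first_vertex" "real (threshold_value adj u) = lap_eigenvalue adj k"
    and v: "v \<noteq> first_vertex" "real (threshold_value adj v) = lap_eigenvalue adj (k - 1)"
    using lap_eigenvalue_attained[OF k(2)] lap_eigenvalue_attained[OF k(3)] by metis
  have "u \<in> top_vertices" "v \<in> top_vertices"
    using u v t t_le lap_eigenvalue_less_iff[of t k] lap_eigenvalue_less_iff[of t "k - 1"]
    by (auto simp: top_vertices_def)
  moreover have "threshold_value adj v < threshold_value adj u"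
    using u v k lap_eigenvalue_less_iff[of "k - 1" k] by simp
  ultimately show False
    using eq by (metis less_irrefl linorder_neqE)
qed

lemma threshold_vector_in_low_eigenspace:
  assumes "j \<noteq> first_vertex" "j \<notin> top_vertices"
  shows "threshold_vector j \<in> (\<Union>i\<in>{0..t}. lap_eigenspace adj i)"
proof -
  obtain i where i: "i \<in> {1..k}" "real (threshold_value adj j) = lap_eigenvalue adj i"
    using threshold_value_index[OF assms(1)] .
  then have "i \<le> t"
    using assms t t_le lap_eigenvalue_less_iff[of t i] by (auto simp: top_vertices_def)
  then show ?thesis
    using laplacian_threshold_vector[OF assms(1)] i(2) by (auto simp: lap_eigenspace_def)
qed

lemma threshold_vector_in_top_eigenspace:
  assumes "j \<in> top_vertices"
  shows "threshold_vector j \<in> (\<Union>i\<in>{t+1..k}. lap_eigenspace adj i)"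
proof -
  have j: "j \<noteq> first_vertex" using assms by (simp add: top_vertices_def)
  obtain i where i: "i \<in> {1..k}" "real (threshold_value adj j) = lap_eigenvalue adj i"
    using threshold_value_index[OF j] .
  then have "t < i"
    using assms t t_le lap_eigenvalue_less_iff[of t i] by (auto simp: top_vertices_def)
  then show ?thesis
    using laplacian_threshold_vector[OF j] i by (force simp: lap_eigenspace_def)
qed

lemma top_threshold_vector_orthogonal:
  assumes "j \<in> top_vertices" "x \<in> lap_eigenspace adj i" "i \<le> t"
  shows "threshold_vector j \<bullet> x = 0"
proof (rule laplacian_eigenvectors_orthogonal[OF adj_sym laplacian_threshold_vector])
  show "laplacian adj *v x = lap_eigenvalue adj i *\<^sub>R x"
    using assms(2) by (simp add: lap_eigenspace_def)
  show "real (threshold_value adj j) \<noteq> lap_eigenvalue adj i"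
    using assms t t_le lap_eigenvalue_less_iff[of t i] by (auto simp: top_vertices_def)
  show "j \<noteq> first_vertex" using assms(1) by (simp add: top_vertices_def)
qed

lemma low_threshold_vector_orthogonal:
  assumes "j \<notin> top_vertices" "j \<noteq> first_vertex" "x \<in> lap_eigenspace adj i" "i \<in> {t+1..k}"
  shows "threshold_vector j \<bullet> x = 0"
proof (rule laplacian_eigenvectors_orthogonal[OF adj_sym laplacian_threshold_vector])
  show "laplacian adj *v x = lap_eigenvalue adj i *\<^sub>R x"
    using assms(3) by (simp add: lap_eigenspace_def)
  show "real (threshold_value adj j) \<noteq> lap_eigenvalue adj i"
    using assms t t_le lap_eigenvalue_less_iff[of t i] by (auto simp: top_vertices_def)
  show "j \<noteq> first_vertex" by fact
qed

text \<open>Each top vertex supplies one basis vector of exactly one of the eigenspaces. This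
  supplies the dimension of the simplex.\<close>

lemma eigen_dim_eq_card: "eigen_dim adj t k = card top_vertices"
proof -
  let ?J = "\<lambda>i. {j. j \<noteq> first_vertex \<and> real (threshold_value adj j) = lap_eigenvalue adj i}"
  have dim: "dim (lap_eigenspace adj i) = card (?J i)" if i: "i \<in> {t+1..k}" for i
  proof -
    have "i \<in> {1..k}" using i by auto
    then obtain j where j: "j \<noteq> first_vertex" "real (threshold_value adj j) = lap_eigenvalue adj i"
      by (rule lap_eigenvalue_attained)
    show ?thesis
      using dim_eigenspace[OF threshold_value_pos[OF j(1)]]
      by (simp add: lap_eigenspace_def j(2)[symmetric])
  qed
  have union: "top_vertices = (\<Union>i\<in>{t+1..k}. ?J i)"
  proof (intro set_eqI iffI)
    fix j assume "j \<in> (\<Union>i\<in>{t+1..k}. ?J i)"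
    then show "j \<in> top_vertices"
      using t t_le lap_eigenvalue_less_iff[of t] by (force simp: top_vertices_def)
  next
    fix j assume j: "j \<in> top_vertices"
    then have first: "j \<noteq> first_vertex" by (simp add: top_vertices_def)
    obtain i where i: "i \<in> {1..k}" "real (threshold_value adj j) = lap_eigenvalue adj i"
      using threshold_value_index[OF first] .
    then have "t < i"
      using j t t_le lap_eigenvalue_less_iff[of t i] by (auto simp: top_vertices_def)
    then show "j \<in> (\<Union>i\<in>{t+1..k}. ?J i)" using i first by auto
  qed
  have "?J i \<inter> ?J j = {}" if "i \<in> {t+1..k}" "j \<in> {t+1..k}" "i \<noteq> j" for i j
    using that lap_eigenvalue_less_iff[of i j] lap_eigenvalue_less_iff[of j i] by auto
  then have "card top_vertices = (\<Sum>i\<in>{t+1..k}. card (?J i))"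
    unfolding union by (intro card_UN_disjoint) auto
  then show ?thesis using dim by (simp add: eigen_dim_def)
qed

end

section \<open>Averaging vectors\<close>

text \<open>Phrased by inner products so that closure under linear combinations is immediate; the
  mean-value form is \<open>averagingD\<close>.\<close>

definition averaging :: "'n::{finite,linorder} set \<Rightarrow> real ^ 'n::{finite,linorder} \<Rightarrow> bool" where
  "averaging T h \<longleftrightarrow> (\<forall>j. j \<noteq> first_vertex \<and> j \<notin> T \<longrightarrow> threshold_vector j \<bullet> h = 0)"

lemma averagingD:
  assumes "averaging T h" "j \<noteq> first_vertex" "j \<notin> T"
  shows "(\<Sum>u<j. h $ u) = real (card {..<j}) * h $ j"
  using assms by (auto simp: averaging_def inner_threshold_vector)

lemma averaging_exists:
  fixes T :: "'n::{finite,linorder} set" and g :: "'n \<Rightarrow> real"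
  obtains h where "averaging T h" "\<And>u. u \<in> insert first_vertex T \<Longrightarrow> h $ u = g u"
proof -
  have "\<exists>f. \<forall>x. (if x \<in> insert first_vertex T then f x = g x
      else (\<Sum>u<x. f u) = real (card {..<x}) * f x)"
  \<comment> \<open>The condition at \<open>x\<close> involves only \<open>f x\<close> and the
    values before \<open>x\<close>, so it can be solved vertex by vertex.\<close>
  proof (rule dependent_wf_choice[OF wf_vertex_less])
    fix x :: 'n and f f' :: "'n \<Rightarrow> real" and r
    assume "\<And>z. (z, x) \<in> {(u, v). u < v} \<Longrightarrow> f z = f' z"
    then have "(\<Sum>u<x. f u) = (\<Sum>u<x. f' u)" by (intro sum.cong) auto
    then show "(if x \<in> insert first_vertex T then r = g x
        else (\<Sum>u<x. f u) = real (card {..<x}) * r) \<longleftrightarrow>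
      (if x \<in> insert first_vertex T then r = g x
        else (\<Sum>u<x. f' u) = real (card {..<x}) * r)" by simp
  next
    fix x :: 'n and f :: "'n \<Rightarrow> real"
    show "\<exists>r. if x \<in> insert first_vertex T then r = g x
        else (\<Sum>u<x. f u) = real (card {..<x}) * r"
    proof (cases "x \<in> insert first_vertex T")
      case False
      then have "card {..<x} > 0" using card_lessThan_pos by blast
      then show ?thesis
        using False by (intro exI[of _ "(\<Sum>u<x. f u) / real (card {..<x})"]) auto
    qed auto
  qed
  then obtain f where f: "\<And>x. if x \<in> insert first_vertex T then f x = g x
      else (\<Sum>u<x. f u) = real (card {..<x}) * f x" by blast
  show ?thesis
  proof (rule that[of "\<chi> u. f u"])
    show "averaging T (\<chi> u. f u)"
      unfolding averaging_def inner_threshold_vector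
    proof (intro allI impI)
      fix j assume "j \<noteq> first_vertex \<and> j \<notin> T"
      then show "(\<Sum>u<j. (\<chi> u. f u) $ u) - real (card {..<j}) * (\<chi> u. f u) $ j = 0"
        using f[of j] by simp
    qed
    show "(\<chi> u. f u) $ u = g u" if "u \<in> insert first_vertex T" for u
      using f[of u] that by simp
  qed
qed

text \<open>A maximum principle: means of earlier entries stay in any interval containing the
  prescribed ones. The case \<open>a = b\<close> serves as uniqueness.\<close>

lemma averaging_bounds:
  fixes h :: "real ^ 'n::{finite,linorder}"
  assumes h: "averaging T h" and bounds: "\<And>u. u \<in> insert first_vertex T \<Longrightarrow> h $ u \<in> {a..b}"
  shows "h $ v \<in> {a..b}"
proof (induction v rule: vertex_less_induct)
  case (less v)
  show ?case
  proof (cases "v \<in> insert first_vertex T")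
    case True
    then show ?thesis by (rule bounds)
  next
    case False
    then have v: "v \<noteq> first_vertex" "v \<notin> T" by auto
    have "a \<le> h $ u" "h $ u \<le> b" if "u \<in> {..<v}" for u
      using less.IH[of u] that by auto
    then have "real (card {..<v}) * a \<le> real (card {..<v}) * h $ v"
      "real (card {..<v}) * h $ v \<le> real (card {..<v}) * b"
      unfolding averagingD[OF h v, symmetric]
      by (auto intro: sum_bounded_below sum_bounded_above)
    then show ?thesis using card_lessThan_pos[OF v(1)] by simp
  qed
qed

text \<open>The strong form of the principle: one positive entry makes every later mean of
  nonnegative entries positive.\<close>

lemma averaging_strict:
  fixes h :: "real ^ 'n::{finite,linorder}"
  assumes h: "averaging T h" and v: "v \<noteq> first_vertex" "v \<notin> T"
    and nonneg: "\<And>u. 0 \<le> h $ u" and pos: "u < v" "0 < h $ u"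
  shows "0 < h $ v"
proof -
  have "0 < (\<Sum>u<v. h $ u)"
    using pos nonneg by (intro sum_pos2[of _ u]) auto
  then show ?thesis
    using averagingD[OF h v] by (metis of_nat_0_le_iff zero_less_mult_pos order_le_less mult_zero_left less_irrefl)
qed

lemma averaging_minus: "averaging T (x - y)" if "averaging T x" "averaging T y"
  using that by (auto simp: averaging_def inner_diff_right)

lemma averaging_scaleR: "averaging T (c *\<^sub>R x)" if "averaging T x"
  using that by (auto simp: averaging_def)

lemma threshold_vector_inner_one: "threshold_vector j \<bullet> 1 = 0"
  by (simp add: inner_threshold_vector)

lemma averaging_one: "averaging T 1"
  by (simp add: averaging_def threshold_vector_inner_one)

section \<open>Designs of strength t as averaging weights\<close>

context threshold_design
begin

text \<open>Extension by zero turns weights on different sets into vectors of one space.\<close>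

definition extended_weight :: "'n set \<Rightarrow> ('n \<Rightarrow> real) \<Rightarrow> real ^ 'n::{finite,linorder}" where
  "extended_weight W a = (\<chi> v. if v \<in> W then a v else 0)"

lemma averages_iff:
  "averages W a f \<longleftrightarrow> (extended_weight W a - (1 / real CARD('n)) *\<^sub>R 1) \<bullet> f = 0"
proof -
  have "extended_weight W a \<bullet> f = (\<Sum>v\<in>UNIV. if v \<in> W then a v * f $ v else 0)"
    by (auto simp: inner_vec_def extended_weight_def intro!: sum.cong)
  also have "\<dots> = (\<Sum>w\<in>W. a w * f $ w)"
    by (simp add: sum.inter_restrict[symmetric])
  finally show ?thesis
    by (auto simp: averages_def inner_diff_left inner_one)
qed

text \<open>Forward, the design is tested on the constant vector and on the eigenvectors of low
  vertices. Backward, the deviation from the uniform weight lies in the span of the top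
  eigenvectors, which is orthogonal to all low eigenspaces.\<close>

lemma graphical_design_iff:
  "graphical_design adj t W a
    \<longleftrightarrow> extended_weight W a \<bullet> 1 = 1 \<and> averaging top_vertices (extended_weight W a)"
  (is "?D \<longleftrightarrow> ?\<alpha> \<bullet> 1 = 1 \<and> averaging top_vertices ?\<alpha>")
proof
  let ?d = "?\<alpha> - (1 / real CARD('n)) *\<^sub>R 1"
  have one: "(1 :: real ^ 'n::{finite,linorder}) \<bullet> 1 = real CARD('n)"
    by (simp add: inner_one)
  {
    assume D: ?D
    have avg: "?d \<bullet> f = 0" if "f \<in> (\<Union>i\<in>{0..t}. lap_eigenspace adj i)" for f
      using D span_base[OF that] by (simp add: graphical_design_def averages_iff)
    have "1 \<in> lap_eigenspace adj 0"
      using laplacian_mult_one[OF adj_irrefl] by (simp add: lap_eigenspace_def lap_eigenvalue_0)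
    then have "?d \<bullet> 1 = 0" by (intro avg) auto
    moreover have "threshold_vector j \<bullet> ?\<alpha> = 0" if "j \<noteq> first_vertex" "j \<notin> top_vertices" for j
    proof -
      have "threshold_vector j \<bullet> ?d = 0"
        using avg[OF threshold_vector_in_low_eigenspace[OF that]] by (simp add: inner_commute)
      then show ?thesis by (simp add: inner_diff_right threshold_vector_inner_one)
    qed
    ultimately show "?\<alpha> \<bullet> 1 = 1 \<and> averaging top_vertices ?\<alpha>"
      using one by (simp add: averaging_def inner_diff_left)
  next
    assume A: "?\<alpha> \<bullet> 1 = 1 \<and> averaging top_vertices ?\<alpha>"
    let ?\<Lambda> = "{l. lap_eigenvalue adj t < real l}"
    have d: "?d \<in> span (threshold_vector ` {j. j \<noteq> first_vertex \<and> threshold_value adj j \<in> ?\<Lambda>})"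
    proof (rule in_span_threshold_vectors)
      show "1 \<bullet> ?d = 0"
        using A one by (simp add: inner_diff_right inner_commute)
      show "threshold_vector j \<bullet> ?d = 0"
        if "j \<noteq> first_vertex" "threshold_value adj j \<notin> ?\<Lambda>" for j
        using A that
        by (auto simp: averaging_def top_vertices_def inner_diff_right threshold_vector_inner_one)
    qed
    have "?d \<bullet> f = 0" if f: "f \<in> lap_eigenspace adj i" "i \<le> t" for f i
    proof -
      have "span (threshold_vector ` {j. j \<noteq> first_vertex \<and> threshold_value adj j \<in> ?\<Lambda>})
          \<subseteq> {x. f \<bullet> x = 0}"
      proof (intro span_minimal subspace_hyperplane subsetI)
        fix x assume "x \<in> threshold_vector ` {j. j \<noteq> first_vertex \<and> threshold_value adj j \<in> ?\<Lambda>}"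
        then obtain j where j: "j \<in> top_vertices" "x = threshold_vector j"
          by (auto simp: top_vertices_def)
        show "x \<in> {x. f \<bullet> x = 0}"
          using top_threshold_vector_orthogonal[OF j(1) f] j(2) by (simp add: inner_commute)
      qed
      then show ?thesis using d by (auto simp: inner_commute)
    qed
    then have "span (\<Union>i\<in>{0..t}. lap_eigenspace adj i) \<subseteq> {f. ?d \<bullet> f = 0}"
      by (intro span_minimal subspace_hyperplane) auto
    then show ?D
      by (auto simp: graphical_design_def averages_iff)
  }
qed

lemma exists_minimal_nonuniform_design:
  "\<exists>W. minimal_positively_weighted_design adj t W \<and> \<not> uniformly_weighted_design adj t W"
proof -
  let ?W = "- top_vertices"
  have mem: "extended_weight W a $ v = (if v \<in> W then a v else 0)" for W a v
    by (simp add: extended_weight_def)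
  \<comment> \<open>This \<open>h\<close> is positive exactly outside \<open>top_vertices\<close>;
    divided by its sum it gives the weights on \<open>?W\<close>.\<close>
  obtain h where h: "averaging top_vertices h"
    and hV: "\<And>u. u \<in> insert first_vertex top_vertices \<Longrightarrow> h $ u = (if u = first_vertex then 1 else 0)"
    using averaging_exists[of top_vertices "\<lambda>u. if u = first_vertex then 1 else 0"] by blast
  have h1: "h $ first_vertex = 1" using hV[of first_vertex] by simp
  have hT: "h $ u = 0" if "u \<in> top_vertices" for u
    using hV[of u] that first_not_top by auto
  have nonneg: "0 \<le> h $ u" for u
  proof -
    have "h $ u \<in> {0..1}"
      using averaging_bounds[OF h, of 0 1] hV by simp
    then show ?thesis by simp
  qed
  have pos: "0 < h $ u" if "u \<notin> top_vertices" for u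
    using averaging_strict[OF h _ that nonneg, of first_vertex] first_vertex_less[of u] h1
    by (cases "u = first_vertex") auto
  define s where "s = (\<Sum>u\<in>UNIV. h $ u)"
  have "0 < s"
    unfolding s_def using nonneg h1 by (intro sum_pos2[of _ first_vertex]) auto
  define a where "a v = h $ v / s" for v
  have ext: "extended_weight ?W a = (1 / s) *\<^sub>R h"
    using hT by (auto simp: vec_eq_iff mem a_def)
  have "(1 / s) *\<^sub>R h \<bullet> 1 = 1"
    using \<open>0 < s\<close> by (simp add: inner_commute[of h] inner_one s_def[symmetric])
  then have "graphical_design adj t ?W a"
    unfolding graphical_design_iff ext using averaging_scaleR[OF h] by blast
  moreover have "\<forall>w\<in>?W. a w > 0"
    using pos \<open>0 < s\<close> by (simp add: a_def)
  ultimately have "positively_weighted_design adj t ?W"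
    unfolding positively_weighted_design_def by blast
  \<comment> \<open>An averaging weight vanishing on \<open>top_vertices\<close> is positive at the
    first vertex, since otherwise it would be 0 and could not sum to 1. Positivity then spreads to
    all of \<open>?W\<close>, so the support cannot shrink.\<close>
  moreover have "\<not> positively_weighted_design adj t W'" if W': "W' \<subset> ?W" for W'
  proof
    assume "positively_weighted_design adj t W'"
    then obtain a' where a': "\<And>w. w \<in> W' \<Longrightarrow> a' w > 0" and D: "graphical_design adj t W' a'"
      unfolding positively_weighted_design_def by blast
    let ?\<alpha> = "extended_weight W' a'"
    have \<alpha>: "?\<alpha> \<bullet> 1 = 1" "averaging top_vertices ?\<alpha>"
      using D by (simp_all add: graphical_design_iff)
    have \<alpha>0: "0 \<le> ?\<alpha> $ v" for v using less_imp_le[OF a'[of v]] by (simp add: mem)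
    have \<alpha>T: "?\<alpha> $ v = 0" if "v \<in> top_vertices" for v using that W' by (auto simp: mem)
    have "?\<alpha> $ first_vertex \<noteq> 0"
    proof
      assume zero: "?\<alpha> $ first_vertex = 0"
      have "?\<alpha> $ v \<in> {0..0}" for v
        by (rule averaging_bounds[OF \<alpha>(2)]) (use zero \<alpha>T in auto)
      then have "?\<alpha> = 0" by (simp add: vec_eq_iff)
      then show False using \<alpha>(1) by simp
    qed
    then have first: "0 < ?\<alpha> $ first_vertex" using \<alpha>0[of first_vertex] by simp
    have "v \<in> W'" if "v \<in> ?W" for v
    proof -
      have "0 < ?\<alpha> $ v"
      proof (cases "v = first_vertex")
        case False
        then show ?thesis
          using averaging_strict[OF \<alpha>(2) False _ \<alpha>0 first_vertex_less[OF False] first] that by simp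
      qed (use first in simp)
      then show ?thesis by (simp add: mem split: if_splits)
    qed
    then show False using W' by blast
  qed
  moreover have "\<not> uniformly_weighted_design adj t ?W"
  proof
    assume "uniformly_weighted_design adj t ?W"
    then obtain b c where c: "c > 0" "\<And>w. w \<in> ?W \<Longrightarrow> b w = c" and D: "graphical_design adj t ?W b"
      unfolding uniformly_weighted_design_def by blast
    let ?\<alpha> = "extended_weight ?W b"
    obtain i j where ij: "i \<in> top_vertices" "j \<notin> top_vertices" "i < j"
      using top_before_low by blast
    have j: "j \<noteq> first_vertex" using ij(3) first_vertex_le[of i] by auto
    have \<alpha>: "?\<alpha> $ v = (if v \<in> top_vertices then 0 else c)" for v
      using c(2)[of v] by (simp add: mem)
    \<comment> \<open>This vector would be \<open>c\<close> on \<open>top_vertices\<close> and 0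
      elsewhere, but its entry at \<open>j\<close> is a mean involving the positive entry at
      \<open>i\<close>.\<close>
    have "averaging top_vertices (c *\<^sub>R 1 - ?\<alpha>)"
      using D unfolding graphical_design_iff
      by (intro averaging_minus averaging_scaleR averaging_one) blast
    then have "0 < (c *\<^sub>R 1 - ?\<alpha>) $ j"
      by (rule averaging_strict[of top_vertices _ j i]) (use ij c(1) j \<alpha> in auto)
    then show False using \<alpha>[of j] ij(2) by simp
  qed
  ultimately show ?thesis
    unfolding minimal_positively_weighted_design_def by blast
qed

section \<open>Averaging properties of the eigenconfiguration\<close>

text \<open>Every row of \<open>B\<close> is an averaging vector, being orthogonal to the
  eigenvectors of low vertices; read by columns, this makes the point of \<open>j\<close> the mean
  of the earlier points.\<close>

lemma eigen_matrix_averaging: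
  fixes B :: "(real ^ 'n::{finite,linorder}) ^ 'b::finite"
  assumes B: "eigen_matrix adj t k B" and j: "j \<noteq> first_vertex" "j \<notin> top_vertices"
  shows "(\<Sum>u<j. column u B) = real (card {..<j}) *\<^sub>R column j B"
proof -
  obtain C where C: "\<And>i. i \<in> {t+1..k} \<Longrightarrow> span (C i) = lap_eigenspace adj i"
    and rows: "rows B = (\<Union>i\<in>{t+1..k}. C i)"
    using B unfolding eigen_matrix_def by blast
  have "(\<Sum>u<j. B $ r $ u) = real (card {..<j}) * B $ r $ j" for r
  proof -
    have "row r B \<in> rows B" by (auto simp: rows_def)
    then obtain i where i: "i \<in> {t+1..k}" "row r B \<in> C i" unfolding rows by blast
    then have "row r B \<in> lap_eigenspace adj i" using C[OF i(1)] span_base by blast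
    then have "threshold_vector j \<bullet> row r B = 0"
      using low_threshold_vector_orthogonal[OF j(2,1)] i(1) by blast
    then show ?thesis by (simp add: inner_threshold_vector row_def)
  qed
  then show ?thesis by (simp add: vec_eq_iff column_def sum_component)
qed

text \<open>After subtracting its mean \<open>c\<close>, an averaging vector lies in the row space
  of \<open>B\<close>; the coefficients form \<open>y\<close>.\<close>

lemma eigen_matrix_affine:
  fixes B :: "(real ^ 'n::{finite,linorder}) ^ 'b::finite"
  assumes B: "eigen_matrix adj t k B" and h: "averaging top_vertices h"
  shows "\<exists>c y. \<forall>v. h $ v = c + y \<bullet> column v B"
proof -
  obtain C where C: "\<And>i. i \<in> {t+1..k} \<Longrightarrow> span (C i) = lap_eigenspace adj i"
    and rows: "rows B = (\<Union>i\<in>{t+1..k}. C i)"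
    using B unfolding eigen_matrix_def by blast
  define c where "c = (1 \<bullet> h) / real CARD('n)"
  let ?\<Lambda> = "{l. lap_eigenvalue adj t < real l}"
  have "h - c *\<^sub>R 1 \<in> span (threshold_vector ` {j. j \<noteq> first_vertex \<and> threshold_value adj j \<in> ?\<Lambda>})"
  proof (rule in_span_threshold_vectors)
    show "1 \<bullet> (h - c *\<^sub>R 1) = 0"
      by (simp add: inner_diff_right c_def inner_one)
    show "threshold_vector j \<bullet> (h - c *\<^sub>R 1) = 0"
      if "j \<noteq> first_vertex" "threshold_value adj j \<notin> ?\<Lambda>" for j
      using h that
      by (auto simp: averaging_def top_vertices_def inner_diff_right threshold_vector_inner_one)
  qed
  moreover have "threshold_vector ` {j. j \<noteq> first_vertex \<and> threshold_value adj j \<in> ?\<Lambda>} \<subseteq> span (rows B)"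
  proof
    fix x assume "x \<in> threshold_vector ` {j. j \<noteq> first_vertex \<and> threshold_value adj j \<in> ?\<Lambda>}"
    then obtain j where j: "j \<in> top_vertices" "x = threshold_vector j"
      by (auto simp: top_vertices_def)
    then obtain i where i: "i \<in> {t+1..k}" "x \<in> lap_eigenspace adj i"
      using threshold_vector_in_top_eigenspace[OF j(1)] by blast
    have "C i \<subseteq> rows B" unfolding rows using i(1) by blast
    then show "x \<in> span (rows B)"
      using C[OF i(1)] i(2) span_mono by blast
  qed
  ultimately have "h - c *\<^sub>R 1 \<in> span (rows B)"
    using span_minimal[OF _ subspace_span] by blast
  moreover have "span (rows B) \<subseteq> range ((*v) (transpose B))"
  proof (intro span_minimal subsetI)
    fix x assume "x \<in> rows B"
    then obtain r where r: "x = row r B" by (auto simp: rows_def)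
    have "transpose B *v axis r 1 = row r B"
      by (simp add: matrix_vector_mult_basis column_transpose)
    then show "x \<in> range ((*v) (transpose B))" unfolding r by (metis rangeI)
  qed (intro linear_subspace_image matrix_vector_mul_linear subspace_UNIV)
  ultimately obtain y where y: "h - c *\<^sub>R 1 = transpose B *v y" by blast
  have "h $ v = c + y \<bullet> column v B" for v
  proof -
    have "(h - c *\<^sub>R 1) $ v = y \<bullet> column v B"
      unfolding y by (simp add: matrix_vector_mul_component inner_commute transpose_def column_def)
    then show ?thesis by simp
  qed
  then show ?thesis by blast
qed

end

section \<open>Simplices with configuration points inside faces\<close>

text \<open>While the point is on the relative boundary, descend to a facet containing it; the
  dimension drops each time.\<close>

lemma polyhedron_point_in_rel_interior_of_face:
  fixes P :: "'a::euclidean_space set"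
  assumes "polyhedron P" "x \<in> P"
  obtains F where "F face_of P" "x \<in> rel_interior F"
  using assms
\<comment> \<open>Adding 1 makes the measure nonnegative before \<open>nat\<close>, as
  \<open>aff_dim\<close> can be -1.\<close>
proof (induction "nat (aff_dim P + 1)" arbitrary: P thesis rule: less_induct)
  case less
  show ?case
  proof (cases "x \<in> rel_interior P")
    case True
    then show ?thesis
      using less.prems(1) face_of_refl polyhedron_imp_convex[OF less.prems(2)] by blast
  next
    case False
    then obtain G where G: "G facet_of P" "x \<in> G"
      using rel_boundary_of_polyhedron[OF less.prems(2)] less.prems(3) by blast
    then have face: "G face_of P" and dim: "aff_dim G = aff_dim P - 1"
      by (auto simp: facet_of_def)
    have "nat (aff_dim G + 1) < nat (aff_dim P + 1)"
      using dim aff_dim_geq[of G] by linarith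
    moreover have "polyhedron G"
      using face less.prems(2) by (rule face_of_polyhedron_polyhedron[rotated])
    ultimately obtain F where "F face_of G" "x \<in> rel_interior F"
      using less.hyps[of G] G(2) by blast
    then show ?thesis
      using less.prems(1) face face_of_trans by blast
  qed
qed

lemma affine_constant_from_rel_interior:
  fixes F :: "'a::euclidean_space set"
  assumes "convex F" "z \<in> rel_interior F" "x \<in> F"
    and bound: "\<And>w. w \<in> F \<Longrightarrow> y \<bullet> z \<le> y \<bullet> w"
  shows "y \<bullet> x = y \<bullet> z"
proof -
  have "F \<noteq> {}" using assms(3) by blast
  \<comment> \<open>With \<open>e > 1\<close>, this is a point of \<open>F\<close> beyond
    \<open>z\<close> as seen from \<open>x\<close>; a larger value at \<open>x\<close> would force a
    smaller one there.\<close>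
  then obtain e where e: "e > 1" "(1 - e) *\<^sub>R x + e *\<^sub>R z \<in> F"
    using convex_rel_interior_iff[of F z] assms(1-3) by blast
  have "y \<bullet> z \<le> (1 - e) * (y \<bullet> x) + e * (y \<bullet> z)"
    using bound[OF e(2)] by (simp add: inner_add_right)
  then have "(e - 1) * (y \<bullet> x) \<le> (e - 1) * (y \<bullet> z)"
    by (simp add: algebra_simps)
  then have "y \<bullet> x \<le> y \<bullet> z" using e(1) by simp
  then show ?thesis using bound[OF assms(3)] by simp
qed

text \<open>Isolates what the polytope arguments take from the matrix, independently of the chosen
  bases.\<close>

locale averaging_configuration =
  fixes T :: "'n::{finite,linorder} set" and p :: "'n \<Rightarrow> 'a::euclidean_space"
  assumes first: "first_vertex \<notin> T"
    and mean: "\<And>j. j \<noteq> first_vertex \<Longrightarrow> j \<notin> T \<Longrightarrow> (\<Sum>u<j. p u) = real (card {..<j}) *\<^sub>R p j"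
    and affine_function: "\<And>h. averaging T h \<Longrightarrow> \<exists>c y. \<forall>v. h $ v = c + y \<bullet> p v"
begin

abbreviation "V \<equiv> insert first_vertex T"

text \<open>For \<open>u\<close> in \<open>V\<close>, the affine function obtained is the
  barycentric coordinate belonging to the vertex \<open>p u\<close>.\<close>

lemma barycentric_coordinate:
  obtains h c y where "averaging T h" "\<And>v. h $ v = c + y \<bullet> p v"
    "\<And>w. w \<in> V \<Longrightarrow> h $ w = (if w = u then 1 else 0)"
  using averaging_exists[of T "\<lambda>w. if w = u then 1 else 0"] affine_function by metis

lemma inj_on_vertices: "inj_on p V"
proof (rule inj_onI)
  fix u w assume uw: "u \<in> V" "w \<in> V" "p u = p w"
  obtain h c y where "\<And>v. h $ v = c + y \<bullet> p v" "\<And>w. w \<in> V \<Longrightarrow> h $ w = (if w = u then 1 else 0)"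
    using barycentric_coordinate[of u] by metis
  then have "(if w = u then 1 else 0 :: real) = (if u = u then 1 else 0)"
    using uw by metis
  then show "u = w" by (auto split: if_splits)
qed

text \<open>The coordinate of \<open>u\<close> vanishes on the affine hull of the other vertices but
  is 1 at \<open>p u\<close>.\<close>

lemma affine_independent_vertices: "\<not> affine_dependent (p ` V)"
proof
  assume "affine_dependent (p ` V)"
  then obtain u where u: "u \<in> V" "p u \<in> affine hull (p ` V - {p u})"
    unfolding affine_dependent_def by blast
  obtain h c y where h: "\<And>v. h $ v = c + y \<bullet> p v" "\<And>w. w \<in> V \<Longrightarrow> h $ w = (if w = u then 1 else 0)"
    using barycentric_coordinate[of u] by metis
  have "affine hull (p ` V - {p u}) \<subseteq> {x. y \<bullet> x = - c}"
  proof (rule hull_minimal)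
    show "p ` V - {p u} \<subseteq> {x. y \<bullet> x = - c}"
    proof
      fix x assume "x \<in> p ` V - {p u}"
      then obtain w where "w \<in> V" "w \<noteq> u" "x = p w" by blast
      then show "x \<in> {x. y \<bullet> x = - c}" using h(1)[of w] h(2)[of w] by simp
    qed
  qed (rule affine_hyperplane)
  then have "y \<bullet> p u = - c" using u(2) by blast
  then show False using h(1)[of u] h(2)[OF u(1)] by simp
qed

text \<open>Each remaining point is a mean of earlier ones, so induction along the order places it
  in the hull of the vertices.\<close>

lemma convex_hull_configuration: "convex hull (range p) = convex hull (p ` V)"
proof (rule hull_unique)
  show "range p \<subseteq> convex hull (p ` V)"
  proof
    fix x assume "x \<in> range p"
    then obtain v where "x = p v" by blast
    moreover have "p v \<in> convex hull (p ` V)"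
    proof (induction v rule: vertex_less_induct)
      case (less v)
      show ?case
      proof (cases "v \<in> V")
        case True
        then show ?thesis by (intro hull_inc imageI)
      next
        case False
        then have v: "v \<noteq> first_vertex" "v \<notin> T" by auto
        note pos = card_lessThan_pos[OF v(1)]
        have "(\<Sum>u<v. (1 / real (card {..<v})) *\<^sub>R p u) \<in> convex hull (p ` V)"
          using pos less.IH by (intro convex_sum convex_convex_hull) auto
        also have "(\<Sum>u<v. (1 / real (card {..<v})) *\<^sub>R p u) = p v"
          unfolding scaleR_sum_right[symmetric] mean[OF v] using pos by auto
        finally show ?thesis .
      qed
    qed
    ultimately show "x \<in> convex hull (p ` V)" by simp
  qed
  show "convex hull (p ` V) \<subseteq> K" if "range p \<subseteq> K" "convex K" for K
    using that by (intro hull_minimal) auto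
qed (rule convex_convex_hull)

lemma simplex_configuration: "int (card T) simplex convex hull (range p)"
  unfolding simplex_def convex_hull_configuration
proof (intro exI conjI)
  show "\<not> affine_dependent (p ` V)" by (rule affine_independent_vertices)
  show "int (card (p ` V)) = int (card T) + 1"
    using first by (simp only: card_image[OF inj_on_vertices]) simp
qed simp

lemma polyhedron_configuration: "polyhedron (convex hull (range p))"
  by (intro polytope_imp_polyhedron polytope_convex_hull) simp

text \<open>Both \<open>i\<close> and the first vertex precede \<open>j\<close>. One has entry 1 and
  the other 0, so the strict principle for \<open>h\<close> and for \<open>1 - h\<close> excludes
  both ends.\<close>

lemma coordinate_strictly_between:
  assumes ij: "i \<in> T" "j \<notin> T" "i < j"
    and h: "averaging T h" "\<And>w. w \<in> V \<Longrightarrow> h $ w = (if w = u then 1 else 0)"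
    and u: "u \<in> {i, first_vertex}"
  shows "0 < h $ j" "h $ j < 1"
proof -
  have j: "j \<noteq> first_vertex" using ij(3) first_vertex_le[of i] by auto
  have i: "i \<noteq> first_vertex" "first_vertex < j" using ij first first_vertex_less[OF j] by auto
  have bounds: "h $ v \<in> {0..1}" for v
    by (rule averaging_bounds[OF h(1)]) (use h(2) in auto)
  have u': "u \<in> V" "u < j" using u ij i by auto
  have hu: "h $ u = 1" using h(2)[OF u'(1)] by simp
  show "0 < h $ j"
    using averaging_strict[OF h(1) j ij(2) _ u'(2)] bounds hu by simp
  \<comment> \<open>The other one of the two vertices, where \<open>h\<close> is 0.\<close>
  define w where "w = (if u = i then first_vertex else i)"
  have w: "w \<in> V" "w < j" "w \<noteq> u" using u ij i by (auto simp: w_def)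
  have "averaging T (1 - h)" using averaging_minus[OF averaging_one h(1)] .
  moreover have "0 \<le> (1 - h) $ v" for v using bounds[of v] by simp
  moreover have "0 < (1 - h) $ w" using h(2)[OF w(1)] w(3) by simp
  ultimately have "0 < (1 - h) $ j"
    using averaging_strict[of T "1 - h" j w] j ij(2) w(2) by blast
  then show "h $ j < 1" by simp
qed

text \<open>The face around \<open>p j\<close> could have dimension 0 only if \<open>p j\<close>
  were a vertex of the simplex, but its coordinate at \<open>i\<close> is neither 0 nor 1.\<close>

lemma face_around_configuration_point:
  assumes ij: "i \<in> T" "j \<notin> T" "i < j"
  shows "\<exists>F. F face_of convex hull (range p) \<and> 1 \<le> aff_dim F \<and> p j \<in> rel_interior F"
proof -
  let ?P = "convex hull (range p)"
  have "p j \<in> ?P" by (intro hull_inc) simp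
  then obtain F where F: "F face_of ?P" "p j \<in> rel_interior F"
    using polyhedron_point_in_rel_interior_of_face[OF polyhedron_configuration] by blast
  have "1 \<le> aff_dim F"
  proof (rule ccontr)
    assume "\<not> 1 \<le> aff_dim F"
    moreover have "F \<noteq> {}" using F(2) rel_interior_subset by blast
    ultimately have "aff_dim F = 0"
      using aff_dim_geq[of F] aff_dim_empty[of F] by linarith
    then obtain a where "F = {a}" using aff_dim_eq_0 by blast
    then have "F = {p j}" using F(2) rel_interior_subset by blast
    then have "p j extreme_point_of convex hull (p ` V)"
      using F(1) by (simp add: face_of_singleton convex_hull_configuration)
    then have "p j \<in> p ` V"
      using extreme_point_of_convex_hull_affine_independent[OF affine_independent_vertices] by blast
    then obtain w where w: "w \<in> V" "p j = p w" by blast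
    obtain h c y where h: "averaging T h" "\<And>v. h $ v = c + y \<bullet> p v"
      "\<And>w. w \<in> V \<Longrightarrow> h $ w = (if w = i then 1 else 0)"
      using barycentric_coordinate[of i] by metis
    have "h $ j = h $ w" using h(2)[of j] h(2)[of w] w(2) by simp
    then show False
      using coordinate_strictly_between[OF ij h(1,3)] h(3)[OF w(1)] by (simp split: if_splits)
  qed
  then show ?thesis using F by blast
qed

text \<open>The weight is an affine function of the point whose only values on the configuration, 0
  and \<open>c\<close>, are bounds on the whole polytope. Attaining one of them at a relative
  interior point of \<open>F\<close> makes it constant on \<open>F\<close>.\<close>

lemma zero_one_weight_on_face:
  assumes F: "F face_of convex hull (range p)" and i: "p i \<in> rel_interior F"
    and c: "0 < c" and W: "averaging T (\<chi> v. if v \<in> W then c else 0)"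
  shows "{v. p v \<in> F} \<subseteq> W \<or> {v. p v \<in> F} \<inter> W = {}"
proof -
  obtain b y where aff: "\<And>v. (if v \<in> W then c else 0) = b + y \<bullet> p v"
    using affine_function[OF W] by auto
  have conv: "convex F" using F face_of_imp_convex by blast
  have sub: "F \<subseteq> convex hull (range p)" using F face_of_imp_subset by blast
  have "convex hull (range p) \<subseteq> {x. - b \<le> y \<bullet> x} \<inter> {x. y \<bullet> x \<le> c - b}"
  proof (intro hull_minimal convex_Int convex_halfspace_ge convex_halfspace_le subsetI)
    fix x assume "x \<in> range p"
    then obtain v where "x = p v" by blast
    then show "x \<in> {x. - b \<le> y \<bullet> x} \<inter> {x. y \<bullet> x \<le> c - b}"
      using aff[of v] c by (auto split: if_splits)
  qed
  then have range: "- b \<le> y \<bullet> x" "y \<bullet> x \<le> c - b" if "x \<in> F" for x using that sub by auto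
  have const: "y \<bullet> x = y \<bullet> p i" if x: "x \<in> F" for x
  proof (cases "i \<in> W")
    case True
    then have "y \<bullet> p i = c - b" using aff[of i] by simp
    \<comment> \<open>The maximum case is reduced to the lemma about minima by negating
      \<open>y\<close>.\<close>
    then have "(- y) \<bullet> p i \<le> (- y) \<bullet> w" if "w \<in> F" for w
      using range(2)[OF that] by simp
    then have "(- y) \<bullet> x = (- y) \<bullet> p i"
      by (rule affine_constant_from_rel_interior[OF conv i x])
    then show ?thesis by simp
  next
    case False
    then have "y \<bullet> p i = - b" using aff[of i] by simp
    then have "y \<bullet> p i \<le> y \<bullet> w" if "w \<in> F" for w
      using range(1)[OF that] by simp
    then show ?thesis
      by (rule affine_constant_from_rel_interior[OF conv i x])
  qed
  have "v \<in> W \<longleftrightarrow> i \<in> W" if "p v \<in> F" for v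
  proof -
    have "(if v \<in> W then c else 0) = (if i \<in> W then c else 0)"
      using const[OF that] aff[of v] aff[of i] by simp
    then show ?thesis using c by (auto split: if_splits)
  qed
  then show ?thesis by blast
qed

text \<open>The facet opposite the first vertex works: its normal measures the coordinate of that
  vertex, which is strictly between 0 and 1 at \<open>j\<close>.\<close>

lemma facet_without_two_values:
  assumes ij: "i \<in> T" "j \<notin> T" "i < j"
  shows "\<exists>F a. facet_normal (convex hull (range p)) F a \<and> card (range (\<lambda>v. a \<bullet> p v)) \<noteq> 2"
proof -
  let ?P = "convex hull (range p)" and ?o = "first_vertex :: 'n"
  obtain h c y where h: "averaging T h" "\<And>v. h $ v = c + y \<bullet> p v"
    "\<And>w. w \<in> V \<Longrightarrow> h $ w = (if w = ?o then 1 else 0)"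
    using barycentric_coordinate[of ?o] by metis
  \<comment> \<open>The sign makes \<open>a\<close> an outer normal: \<open>a \<bullet> p v\<close>
    is \<open>c - h $ v\<close>, at most \<open>c\<close>, with equality where \<open>h\<close>
    vanishes.\<close>
  define a where "a = - y"
  define F where "F = ?P \<inter> {x. a \<bullet> x = c}"
  have a: "a \<bullet> p v = c - h $ v" for v using h(2)[of v] by (simp add: a_def)
  have ho: "h $ ?o = 1" and hT: "\<And>w. w \<in> T \<Longrightarrow> h $ w = 0"
    using h(3) first by auto
  have "h $ v \<in> {0..1}" for v
    by (rule averaging_bounds[OF h(1)]) (use h(3) in auto)
  then have "range p \<subseteq> {x. a \<bullet> x \<le> c}" using a by auto
  then have le: "?P \<subseteq> {x. a \<bullet> x \<le> c}" by (intro hull_minimal convex_halfspace_le)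
  have "F face_of ?P"
    unfolding F_def using le by (intro face_of_Int_supporting_hyperplane_le convex_convex_hull) auto
  then have "F face_of convex hull (p ` V)" unfolding convex_hull_configuration .
  \<comment> \<open>Faces of a simplex are hulls of sets of its vertices, so it remains to see which
    vertices lie on \<open>F\<close>.\<close>
  then obtain S where S: "S \<subseteq> p ` V" "F = convex hull S"
    unfolding face_of_convex_hull_affine_independent[OF affine_independent_vertices] by blast
  have "p ?o \<notin> F" using a[of ?o] ho by (simp add: F_def)
  then have "S \<subseteq> p ` V - {p ?o}" using S hull_subset[of S convex] by auto
  then have "F \<subseteq> convex hull (p ` V - {p ?o})" unfolding S(2) by (rule hull_mono)
  moreover have "p ` V - {p ?o} \<subseteq> F"
  proof
    fix x assume "x \<in> p ` V - {p ?o}"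
    then obtain w where "w \<in> T" "x = p w" by auto
    moreover have "p w \<in> ?P" by (intro hull_inc) simp
    ultimately show "x \<in> F" using a[of w] hT by (simp add: F_def)
  qed
  then have "convex hull (p ` V - {p ?o}) \<subseteq> F"
    by (rule hull_minimal) (simp add: S(2) convex_convex_hull)
  ultimately have F: "F = convex hull (p ` V - {p ?o})" by blast
  have "p i \<in> ?P" by (intro hull_inc) simp
  then have "p i \<in> F" using a[of i] hT[OF ij(1)] by (simp add: F_def)
  then have "F facet_of ?P"
    unfolding convex_hull_configuration
      facet_of_convex_hull_affine_independent[OF affine_independent_vertices]
    using F by blast
  moreover have "a \<noteq> 0" using a[of ?o] a[of i] ho hT[OF ij(1)] by auto
  ultimately have "facet_normal ?P F a"
    using le F_def unfolding facet_normal_def by blast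
  moreover have "card (range (\<lambda>v. a \<bullet> p v)) \<noteq> 2"
  proof -
    have "0 < h $ j" "h $ j < 1"
      using coordinate_strictly_between[OF ij h(1,3)] by simp_all
    then have "card {c - 1, c - h $ j, c} = 3" by simp
    moreover have "{c - 1, c - h $ j, c} \<subseteq> range (\<lambda>v. a \<bullet> p v)"
    proof -
      have "c - 1 = a \<bullet> p ?o" "c - h $ j = a \<bullet> p j" "c = a \<bullet> p i"
        using a ho hT[OF ij(1)] by simp_all
      then show ?thesis by blast
    qed
    ultimately have "3 \<le> card (range (\<lambda>v. a \<bullet> p v))"
      using card_mono[of "range (\<lambda>v. a \<bullet> p v)" "{c - 1, c - h $ j, c}"] by simp
    then show ?thesis by simp
  qed
  ultimately show ?thesis by blast
qed

end

section \<open>Transfer to an arbitrary choice of eigenbases\<close>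

theorem theorem4p8:
  fixes adj :: "'n::{finite,linorder} \<Rightarrow> 'n \<Rightarrow> bool"
    and I :: "nat \<Rightarrow> 'n set" and k t :: nat
  assumes "threshold_graph adj" and "connected_graph adj"
    and "type_intervals adj k I"
    and "k > 2" and "1 \<le> t" and "t \<le> k - 2"
  shows "(\<forall>B :: (real ^ 'n::{finite,linorder}) ^ 'b::finite. eigen_matrix adj t k B \<longrightarrow>
            int (eigen_dim adj t k) simplex eigenpolytope B \<and>
            (\<exists>F. face_with_interior_point B F) \<and>
            (\<forall>F W. face_with_interior_point B F \<and> uniformly_weighted_design adj t W \<longrightarrow>
               {i. column i B \<in> F} \<subseteq> W \<or> {i. column i B \<in> F} \<inter> W = {}) \<and>
            (\<exists>F a. facet_normal (eigenpolytope B) F a \<and> \<not> two_witness_direction B a)) \<and>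
         (\<exists>W. minimal_positively_weighted_design adj t W \<and>
              \<not> uniformly_weighted_design adj t W)"
proof -
  interpret threshold_design adj I k t
    using assms by unfold_locales
  \<comment> \<open>This one pair yields both the face with an interior point and the facet.\<close>
  obtain i j where ij: "i \<in> top_vertices" "j \<notin> top_vertices" "i < j"
    using top_before_low by blast
  have "int (eigen_dim adj t k) simplex eigenpolytope B \<and>
      (\<exists>F. face_with_interior_point B F) \<and>
      (\<forall>F W. face_with_interior_point B F \<and> uniformly_weighted_design adj t W \<longrightarrow>
         {i. column i B \<in> F} \<subseteq> W \<or> {i. column i B \<in> F} \<inter> W = {}) \<and>
      (\<exists>F a. facet_normal (eigenpolytope B) F a \<and> \<not> two_witness_direction B a)"
    if B: "eigen_matrix adj t k B" for B :: "(real ^ 'n::{finite,linorder}) ^ 'b::finite"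
  proof -
    interpret averaging_configuration top_vertices "\<lambda>v. column v B"
      using first_not_top eigen_matrix_averaging[OF B] eigen_matrix_affine[OF B]
      by unfold_locales
    have "{i. column i B \<in> F} \<subseteq> W \<or> {i. column i B \<in> F} \<inter> W = {}"
      if F: "face_with_interior_point B F" and W: "uniformly_weighted_design adj t W" for F W
    proof -
      obtain a c where c: "0 < c" "\<And>w. w \<in> W \<Longrightarrow> a w = c" and D: "graphical_design adj t W a"
        using W unfolding uniformly_weighted_design_def by blast
      have "extended_weight W a = (\<chi> v. if v \<in> W then c else 0)"
        using c(2) by (simp add: extended_weight_def vec_eq_iff)
      then have "averaging top_vertices (\<chi> v. if v \<in> W then c else 0)"
        using D by (simp add: graphical_design_iff)
      then show ?thesis
        using F zero_one_weight_on_face[OF _ _ c(1)]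
        unfolding face_with_interior_point_def eigenpolytope_def by blast
    qed
    then show ?thesis
      using simplex_configuration face_around_configuration_point[OF ij]
        facet_without_two_values[OF ij]
      unfolding eigen_dim_eq_card face_with_interior_point_def eigenpolytope_def
        two_witness_direction_def
      by blast
  qed
  then show ?thesis using exists_minimal_nonuniform_design by blast
qed

end
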